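(* Let $E,F$ be Banach spaces and let $\mathbf S$ denote any of the classes $$F_k,\quad \Phi_{m,n},\quad \Phi_{m,\infty},\quad \Phi_{\infty,n}\qquad (k=1,2,\dots;\ m,n=0,1,\dots).$$ Then $\mathbf S$ is a smooth submanifold of $B(E,F)$ and is tangent to $\mathbf M(Z)$ at any $Z\in\mathbf S$, i.e. $T_Z\mathbf S=\mathbf M(Z)$ for all $Z\in\mathbf S$.
   Context: $B(E,F)$ is the Banach space of bounded linear operators from $E$ to $F$; $R(\cdot)$ and $N(\cdot)$ denote range and null space. $A\in B(E,F)$ is double-split if $R(A)$ is closed and there are closed subspaces $R^{+}\subset E$, $N^{+}\subset F$ with $E=N(A)\oplus R^{+}$ and $F=R(A)\oplus N^{+}$; $B^{+}(E,F)$ is the set of double-split operators in $B(E,F)$. The classes are $F_k=\{A\in B^+(E,F):\dim R(A)=k\}$, $\Phi_{m,n}=\{A\in B^+(E,F):\dim N(A)=m,\ \operatorname{codim}R(A)=n\}$, $\Phi_{m,\infty}=\{A\in B^+(E,F):\dim N(A)=m,\ \operatorname{codim}R(A)=\infty\}$, $\Phi_{\infty,n}=\{A\in B^+(E,F):\dim N(A)=\infty,\ \operatorname{codim}R(A)=n\}$. $\mathbf M(X)=\{T\in B(E,F):TN(X)\subset R(X)\}$ for $X\in B(E,F)$. A subset $\mathbf S$ of a Banach space $\mathbf B$ is a smooth submanifold if for each $X\in\mathbf S$ there are a closed subspace $\mathbf E_0$ of $\mathbf B$ having a closed complement, a neighborhood $\mathbf U$ of $X$ in $\mathbf B$, and a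 $c^\infty$ diffeomorphism $\varphi$ of $\mathbf U$ onto an open set $\varphi(\mathbf U)\subset\mathbf B$ such that $\varphi(\mathbf S\cap\mathbf U)$ is an open set in $\mathbf E_0$ (the subspace $\mathbf E_0$ may depend on $X$). The tangent space is $T_X\mathbf S=\{\dot c(0): c:(-\delta,\delta)\to\mathbf S\text{ a }c^1\text{ curve with }c(0)=X,\ \delta>0\}$. *)

theory Defs
  imports "HOL-Analysis.Analysis"
begin

definition complementary :: "'a::real_vector set \<Rightarrow> 'a set \<Rightarrow> bool" where
  "complementary V W \<longleftrightarrow>
     subspace V \<and> subspace W \<and> V \<inter> W = {0} \<and> {v + w | v w. v \<in> V \<and> w \<in> W} = UNIV"

text \<open>The library's \<^const>\<open>dim\<close> is 0 on infinite-dimensional spaces, hence the case distinction.\<close>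

definition edim :: "'a::real_vector set \<Rightarrow> enat" where
  "edim V = (if \<exists>B. finite B \<and> V \<subseteq> span B then enat (dim V) else \<infinity>)"

text \<open>The dimension of the quotient by \<open>V\<close>, computed on an algebraic complement of \<open>V\<close>;
  by \<open>ecodim_eq\<close> below the choice of the complement is irrelevant.\<close>

definition ecodim :: "'a::real_vector set \<Rightarrow> enat" where
  "ecodim V = edim (SOME W. complementary V W)"

lemma edim_complement_le:
  assumes "complementary V W" "complementary V W'"
  shows "edim W' \<le> edim W"
proof (cases "\<exists>B. finite B \<and> W \<subseteq> span B")
  case False
  then have "edim W = \<infinity>" unfolding edim_def by (rule if_not_P)
  then show ?thesis by simp
next
  case True
  then obtain B0 where B0: "finite B0" "W \<subseteq> span B0" by blast
  obtain B where B: "B \<subseteq> W" "independent B" "W \<subseteq> span B" "card B = dim W"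
    using basis_exists by blast
  have finB: "finite B"
    using independent_span_bound[OF B0(1) B(2)] B(1) B0(2) by blast
  have sV: "subspace V" and sW: "subspace W" and sW': "subspace W'" and int': "V \<inter> W' = {0}"
    and sum: "{v + w | v w. v \<in> V \<and> w \<in> W} = UNIV"
    and sum': "{v + w | v w. v \<in> V \<and> w \<in> W'} = UNIV"
    using assms by (auto simp: complementary_def)
  have "\<exists>w. w \<in> W' \<and> b - w \<in> V" for b
  proof -
    have "b \<in> {v + w | v w. v \<in> V \<and> w \<in> W'}" using sum' by simp
    then show ?thesis by force
  qed
  then obtain p where p: "\<And>b. p b \<in> W'" "\<And>b. b - p b \<in> V" by metis
  have uniq: "w = p b" if "w \<in> W'" "b - w \<in> V" for w b
  proof -
    have "w - p b \<in> W'" using that p sW' by (auto intro: subspace_diff)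
    moreover have "(b - p b) - (b - w) \<in> V" using that p sV by (blast intro: subspace_diff)
    ultimately have "w - p b \<in> V \<inter> W'" by simp
    then show ?thesis using int' by simp
  qed
  have lin: "linear p"
  proof (rule linearI)
    fix x y :: 'a and c :: real
    have "(x - p x) + (y - p y) \<in> V" using p sV by (blast intro: subspace_add)
    then have "x + y - (p x + p y) \<in> V" by (simp add: algebra_simps)
    then show "p (x + y) = p x + p y"
      using uniq[of "p x + p y" "x + y"] p sW' by (metis subspace_add)
    have "c *\<^sub>R (x - p x) \<in> V" using p sV by (blast intro: subspace_scale)
    then have "c *\<^sub>R x - c *\<^sub>R p x \<in> V" by (simp add: algebra_simps)
    then show "p (c *\<^sub>R x) = c *\<^sub>R p x"
      using uniq[of "c *\<^sub>R p x" "c *\<^sub>R x"] p sW' by (metis subspace_scale)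
  qed
  have "W' \<subseteq> p ` W"
  proof
    fix w' assume w': "w' \<in> W'"
    have "w' \<in> {v + w | v w. v \<in> V \<and> w \<in> W}" using sum by simp
    then obtain v w where vw: "w' = v + w" "v \<in> V" "w \<in> W" by blast
    have "w - w' \<in> V" using vw sV subspace_neg by fastforce
    then show "w' \<in> p ` W" using uniq[OF w', of w] vw(3) by blast
  qed
  also have "\<dots> \<subseteq> p ` span B" using B(3) by blast
  also have "\<dots> = span (p ` B)" using lin by (simp add: linear_span_image)
  finally have sp: "W' \<subseteq> span (p ` B)" .
  then have "dim W' \<le> card (p ` B)" using finB by (simp add: dim_le_card)
  also have "\<dots> \<le> dim W" using finB B(4) card_image_le by metis
  finally show ?thesis using True sp finB by (auto simp: edim_def)
qed

lemma ecodim_eq: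
  assumes "complementary V W"
  shows "ecodim V = edim W"
proof -
  have "complementary V (SOME W. complementary V W)" using assms by (rule someI)
  with assms show ?thesis
    unfolding ecodim_def by (intro antisym edim_complement_le)
qed

definition null_space :: "('a::real_normed_vector \<Rightarrow>\<^sub>L 'b::real_normed_vector) \<Rightarrow> 'a set" where
  "null_space A = {x. blinfun_apply A x = 0}"

definition double_split :: "('a::real_normed_vector \<Rightarrow>\<^sub>L 'b::real_normed_vector) set" where
  "double_split = {A. closed (range (blinfun_apply A)) \<and>
     (\<exists>R. closed R \<and> complementary (null_space A) R) \<and>
     (\<exists>N. closed N \<and> complementary (range (blinfun_apply A)) N)}"

definition rank_class :: "nat \<Rightarrow> ('a::real_normed_vector \<Rightarrow>\<^sub>L 'b::real_normed_vector) set" where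
  "rank_class k = {A \<in> double_split. edim (range (blinfun_apply A)) = enat k}"

definition Phi_class ::
    "enat \<Rightarrow> enat \<Rightarrow> ('a::real_normed_vector \<Rightarrow>\<^sub>L 'b::real_normed_vector) set" where
  "Phi_class m n =
     {A \<in> double_split. edim (null_space A) = m \<and> ecodim (range (blinfun_apply A)) = n}"

definition tangent_ops ::
    "('a::real_normed_vector \<Rightarrow>\<^sub>L 'b::real_normed_vector) \<Rightarrow> ('a \<Rightarrow>\<^sub>L 'b) set" where
  "tangent_ops X = {T. blinfun_apply T ` null_space X \<subseteq> range (blinfun_apply X)}"

text \<open>The iterated spaces of bounded linear maps \<open>L(E, L(E, \<dots> L(E, F)))\<close> do not form a single
  type, so the \<open>k\<close>-th derivative is represented by the corresponding bounded \<open>k\<close>-linear map,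
  whose arguments are given as a list of length \<open>k\<close>.\<close>

definition bounded_multilinear ::
    "nat \<Rightarrow> ('a::real_normed_vector list \<Rightarrow> 'b::real_normed_vector) \<Rightarrow> bool" where
  "bounded_multilinear k M \<longleftrightarrow>
     (\<forall>vs i. length vs = k \<and> i < k \<longrightarrow> linear (\<lambda>h. M (vs[i := h]))) \<and>
     (\<exists>K. \<forall>vs. length vs = k \<longrightarrow> norm (M vs) \<le> K * (\<Prod>v\<leftarrow>vs. norm v))"

text \<open>\<open>D x\<close> restricted to lists of length \<open>k\<close> is the \<open>k\<close>-th Frechet derivative of \<open>f\<close> at \<open>x\<close>. The
  last clause says that the derivative of order \<open>k + 1\<close> is the Frechet derivative of the one of
  order \<open>k\<close>, with respect to the operator norm of \<open>k\<close>-linear maps. Continuity of each derivative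
  follows from the existence of the next one.\<close>

definition cinfinity_on ::
    "'a::real_normed_vector set \<Rightarrow> ('a \<Rightarrow> 'b::real_normed_vector) \<Rightarrow> bool" where
  "cinfinity_on U f \<longleftrightarrow>
     (\<exists>D :: 'a \<Rightarrow> 'a list \<Rightarrow> 'b. \<forall>x\<in>U.
        D x [] = f x \<and>
        (\<forall>k. bounded_multilinear k (D x)) \<and>
        (\<forall>k. \<forall>\<epsilon>>0. \<exists>\<delta>>0. \<forall>h. norm h < \<delta> \<and> x + h \<in> U \<longrightarrow>
           (\<forall>vs. length vs = k \<longrightarrow>
              norm (D (x + h) vs - D x vs - D x (h # vs)) \<le> \<epsilon> * norm h * (\<Prod>v\<leftarrow>vs. norm v))))"

definition cinfinity_diffeo ::
    "'a::real_normed_vector set \<Rightarrow> 'b::real_normed_vector set \<Rightarrow> ('a \<Rightarrow> 'b) \<Rightarrow> bool" where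
  "cinfinity_diffeo U V \<phi> \<longleftrightarrow>
     open U \<and> open V \<and> bij_betw \<phi> U V \<and> cinfinity_on U \<phi> \<and> cinfinity_on V (inv_into U \<phi>)"

definition smooth_submanifold :: "'a::real_normed_vector set \<Rightarrow> bool" where
  "smooth_submanifold S \<longleftrightarrow>
     (\<forall>X\<in>S. \<exists>E\<^sub>0 U (\<phi> :: 'a \<Rightarrow> 'a).
        closed E\<^sub>0 \<and> (\<exists>C. closed C \<and> complementary E\<^sub>0 C) \<and>
        X \<in> U \<and> cinfinity_diffeo U (\<phi> ` U) \<phi> \<and>
        openin (top_of_set E\<^sub>0) (\<phi> ` (S \<inter> U)))"

definition tangent_space :: "'a::real_normed_vector set \<Rightarrow> 'a \<Rightarrow> 'a set" where
  "tangent_space S X =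
     {vector_derivative c (at 0) | c \<delta>.
        \<delta> > 0 \<and> c C1_differentiable_on {-\<delta><..<\<delta>} \<and> c ` {-\<delta><..<\<delta>} \<subseteq> S \<and> c 0 = X}"

end

theory Submission
  imports Defs
begin

text \<open>
  Fix \<open>A\<close> in one of the classes. Both its kernel and its range are complemented, so by the closed
  graph theorem \<open>A\<close> has a bounded generalized inverse \<open>B\<close>, that is \<open>ABA = A\<close> and \<open>BAB = B\<close>
  (\<open>double_split_generalized_inverse\<close>). The projections \<open>I - BA\<close> onto the kernel of \<open>A\<close> and
  \<open>I - AB\<close> onto a complement of its range turn an operator \<open>T\<close> into a block matrix
  \<open>T11, T12, T21, T22\<close>, in which \<open>A\<close> has an invertible block at 11 and zeros elsewhere; the tangent
  operators \<open>M(A)\<close> are those with vanishing block 22.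

  As long as \<open>T11\<close> is invertible, elimination writes \<open>T\<close> as \<open>C (A + V) G\<close> with invertible \<open>C\<close> and
  \<open>G\<close>, where \<open>V = T22 - T21 T11^-1 T12\<close> is the Schur complement (\<open>schur_factorization\<close>). The
  classes are invariant under such equivalences. Moreover \<open>A + V\<close> has a smaller kernel and a larger
  range than \<open>A\<close>, strictly so unless \<open>V = 0\<close>; since each class prescribes a finite dimension for the
  kernel, the range or the cokernel, \<open>A + V\<close> lies in the class of \<open>A\<close> only for \<open>V = 0\<close>. Hence near
  \<open>A\<close> the class is the zero set of the Schur complement (\<open>mem_class_iff_schur\<close>).

  The correction \<open>T21 T11^-1 T12\<close> sits in block 22 and depends on the other three blocks only. So
  \<open>T \<mapsto> T - correction T\<close> is a bijection of the chart domain onto itself with inverse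
  \<open>T \<mapsto> T + correction T\<close>, and it carries the class to \<open>M(A)\<close> (\<open>schur_chart\<close>). For smoothness the
  correction is exhibited as a corner of the inverse of one operator on \<open>E \<times> F\<close> that is affine in
  \<open>T\<close>; thus only operator inversion, affine substitutions, bounded linear images and sums have to be
  differentiated infinitely often, and no products.

  The correction vanishes to second order at \<open>A\<close>, which gives the inclusion of the tangent space in
  \<open>M(A)\<close>. Conversely \<open>T\<close> in \<open>M(A)\<close> has the form \<open>XA + AY\<close> and is the velocity at 0 of the curve
  \<open>(I + tX) A (I + tY)\<close>, which stays in the class by invariance under equivalence.
\<close>

section \<open>Closed graphs and generalized inverses\<close>

text \<open>By Baire's theorem some sublevel set \<open>{x. norm (f x) \<le> n}\<close> is dense in a ball. By symmetry
  and scaling every \<open>x\<close> then has an approximation \<open>a x\<close> within half its norm for which \<open>f (a x)\<close> is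
  controlled; correcting the error repeatedly expands \<open>x\<close> in a series whose image converges
  absolutely, and closedness of the graph identifies the limit with \<open>f x\<close>.\<close>

theorem closed_graph_bounded_linear:
  fixes f :: "'a::banach \<Rightarrow> 'b::banach"
  assumes lin: "linear f" and graph: "closed {(x, y). y = f x}"
  shows "bounded_linear f"
proof -
  interpret f: linear f by (rule lin)
  define C where "C n = closure {x. norm (f x) \<le> real n}" for n :: nat
  have "\<Union>(range C) = UNIV"
  proof -
    have "x \<in> C (nat \<lceil>norm (f x)\<rceil>)" for x
      unfolding C_def by (rule subsetD[OF closure_subset]) (simp add: of_nat_ceiling)
    then show ?thesis by blast
  qed
  then have "interior (\<Union>(range C)) \<noteq> {}" by simp
  moreover have "interior (\<Union>(range C)) = {}" if "\<And>n. interior (C n) = {}"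
  proof -
    have "euclidean interior_of \<Union>(range C) = {}"
    proof (rule Baire_category_alt)
      show "completely_metrizable_space (euclidean :: 'a topology) \<or>
          locally_compact_space (euclidean :: 'a topology) \<and> regular_space (euclidean :: 'a topology)"
        by (rule disjI1[OF completely_metrizable_space_euclidean])
      show "closedin euclidean T \<and> euclidean interior_of T = {}" if "T \<in> range C" for T
        using that \<open>\<And>n. interior (C n) = {}\<close> by (force simp: C_def)
    qed simp
    then show ?thesis by simp
  qed
  ultimately obtain n where "interior (C n) \<noteq> {}" by blast
  then obtain x0 r where r: "r > 0" "ball x0 r \<subseteq> C n"
    by (metis all_not_in_conv mem_interior)
  \<comment> \<open>Half the difference of approximations of \<open>x0 + x\<close> and \<open>x0 - x\<close> moves the ball to the origin.\<close>
  have dense: "\<exists>u. norm (f u) \<le> real n \<and> norm (x - u) < e" if "norm x < r" "e > 0" for x e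
  proof -
    have "x0 + x \<in> C n" "x0 - x \<in> C n" using r that(1) by (auto simp: dist_norm)
    then obtain u v where uv: "norm (f u) \<le> real n" "norm (f v) \<le> real n"
        "dist u (x0 + x) < e" "dist v (x0 - x) < e"
      using \<open>e > 0\<close> unfolding C_def closure_approachable by blast
    have "norm (f u - f v) \<le> real n + real n" using uv norm_triangle_ineq4[of "f u" "f v"] by linarith
    then have 1: "norm (f ((1/2) *\<^sub>R (u - v))) \<le> real n" by (simp add: f.scaleR f.diff)
    have "x - (1/2) *\<^sub>R (u - v) = (1/2) *\<^sub>R ((v - (x0 - x)) - (u - (x0 + x)))"
      by (simp add: algebra_simps flip: scaleR_add_left)
    then have "norm (x - (1/2) *\<^sub>R (u - v)) = norm ((v - (x0 - x)) - (u - (x0 + x))) / 2" by simp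
    also have "\<dots> \<le> (norm (v - (x0 - x)) + norm (u - (x0 + x))) / 2"
      using norm_triangle_ineq4[of "v - (x0 - x)" "u - (x0 + x)"] by simp
    also have "\<dots> < e" using uv by (simp add: dist_norm)
    finally show ?thesis using 1 by blast
  qed
  define K where "K = 2 * real n / r"
  have K0: "K \<ge> 0" using r by (simp add: K_def)
  have "\<exists>u. norm (f u) \<le> K * norm x \<and> norm (x - u) \<le> norm x / 2" for x
  proof (cases "x = 0")
    case True
    then show ?thesis by (intro exI[of _ 0]) simp
  next
    case False
    define c where "c = r / (2 * norm x)"
    have c: "c > 0" "c * norm x = r / 2" using r False by (auto simp: c_def)
    obtain v where v: "norm (f v) \<le> real n" "norm (c *\<^sub>R x - v) < r / 4"
      using dense[of "c *\<^sub>R x" "r / 4"] c r by auto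
    have "norm (f ((1/c) *\<^sub>R v)) = norm (f v) / c" using c by (simp add: f.scaleR)
    also have "\<dots> \<le> real n / c" using v c by (intro divide_right_mono) auto
    also have "\<dots> = K * norm x" using r False by (simp add: c_def K_def)
    finally have 1: "norm (f ((1/c) *\<^sub>R v)) \<le> K * norm x" .
    have "x - (1/c) *\<^sub>R v = (1/c) *\<^sub>R (c *\<^sub>R x - v)" using c by (simp add: algebra_simps)
    then have "norm (x - (1/c) *\<^sub>R v) = norm (c *\<^sub>R x - v) / c" using c by simp
    also have "\<dots> \<le> (r / 4) / c" using v c by (intro divide_right_mono) auto
    also have "\<dots> = norm x / 2" using r False by (simp add: c_def)
    finally show ?thesis using 1 by blast
  qed
  then obtain a where a: "\<And>x. norm (f (a x)) \<le> K * norm x" "\<And>x. norm (x - a x) \<le> norm x / 2"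
    by metis
  have bound: "norm (f x) \<le> norm x * (2 * K)" for x
  proof -
    \<comment> \<open>The error that remains after \<open>n\<close> corrections.\<close>
    define s where "s n = ((\<lambda>z. z - a z) ^^ n) x" for n
    have s0: "s 0 = x" and sS: "s (Suc n) = s n - a (s n)" for n by (simp_all add: s_def)
    have sb: "norm (s n) \<le> norm x * (1/2) ^ n" for n
    proof (induction n)
      case (Suc n)
      then show ?case using a(2)[of "s n"] by (simp add: sS)
    qed (simp add: s0)
    have psum: "(\<Sum>i<n. a (s i)) = x - s n" for n
      by (induction n) (simp_all add: s0 sS)
    have g: "(\<lambda>n. norm x * (1/2) ^ n) sums (norm x * 2)"
      using sums_mult[OF geometric_sums[of "1/2 :: real"], of "norm x"] by simp
    have "s \<longlonglongrightarrow> 0"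
      by (rule Lim_null_comparison[OF _ summable_LIMSEQ_zero[OF sums_summable[OF g]]])
        (simp add: sb)
    then have lim1: "(\<lambda>n. \<Sum>i<n. a (s i)) \<longlonglongrightarrow> x"
      using tendsto_diff[OF tendsto_const[of x], of s 0] by (simp add: psum)
    have fb: "norm (f (a (s i))) \<le> K * (norm x * (1/2) ^ i)" for i
      using a(1)[of "s i"] mult_left_mono[OF sb K0] by (rule order_trans)
    have gK: "(\<lambda>i. K * (norm x * (1/2) ^ i)) sums (K * (norm x * 2))" using sums_mult[OF g] .
    have sm: "summable (\<lambda>i. norm (f (a (s i))))"
      by (rule summable_comparison_test'[OF sums_summable[OF gK], of 0]) (simp add: fb)
    then have lim2: "(\<lambda>n. \<Sum>i<n. f (a (s i))) \<longlonglongrightarrow> (\<Sum>i. f (a (s i)))"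
      by (rule summable_LIMSEQ[OF summable_norm_cancel])
    have "(x, \<Sum>i. f (a (s i))) \<in> {(x, y). y = f x}"
    proof (rule closed_sequentially[OF graph])
      show "(\<lambda>n. (\<Sum>i<n. a (s i), \<Sum>i<n. f (a (s i)))) \<longlonglongrightarrow> (x, \<Sum>i. f (a (s i)))"
        by (rule tendsto_Pair[OF lim1 lim2])
    qed (simp add: f.sum)
    then have "f x = (\<Sum>i. f (a (s i)))" by simp
    also have "norm \<dots> \<le> (\<Sum>i. norm (f (a (s i))))" by (rule summable_norm[OF sm])
    also have "\<dots> \<le> (\<Sum>i. K * (norm x * (1/2) ^ i))"
      by (rule suminf_le[OF fb sm sums_summable[OF gK]])
    also have "\<dots> = K * (norm x * 2)" by (rule sums_unique[OF gK, symmetric])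
    also have "\<dots> = norm x * (2 * K)" by simp
    finally show ?thesis .
  qed
  show ?thesis by (rule bounded_linear_intro[OF f.add f.scaleR bound])
qed

lemma complementary_projection:
  assumes "complementary V W"
  obtains p where "linear p" "\<And>x. p x \<in> W" "\<And>x. x - p x \<in> V"
    "\<And>x w. w \<in> W \<Longrightarrow> x - w \<in> V \<Longrightarrow> w = p x"
proof -
  have sV: "subspace V" and sW: "subspace W" and int: "V \<inter> W = {0}"
    and sum: "{v + w | v w. v \<in> V \<and> w \<in> W} = UNIV"
    using assms by (auto simp: complementary_def)
  have "\<exists>w. w \<in> W \<and> x - w \<in> V" for x
  proof -
    have "x \<in> {v + w | v w. v \<in> V \<and> w \<in> W}" using sum by simp
    then show ?thesis by force
  qed
  then obtain p where p: "\<And>x. p x \<in> W" "\<And>x. x - p x \<in> V" by metis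
  have uniq: "w = p x" if "w \<in> W" "x - w \<in> V" for w x
  proof -
    have "w - p x \<in> W" using that p sW by (auto intro: subspace_diff)
    moreover have "(x - p x) - (x - w) \<in> V" using that p sV by (blast intro: subspace_diff)
    ultimately have "w - p x \<in> V \<inter> W" by simp
    then show ?thesis using int by simp
  qed
  have "linear p"
  proof (rule linearI)
    fix x y and c :: real
    have "(x - p x) + (y - p y) \<in> V" using p sV by (blast intro: subspace_add)
    then show "p (x + y) = p x + p y"
      using uniq[of "p x + p y" "x + y"] p sW by (simp add: algebra_simps subspace_add)
    have "c *\<^sub>R (x - p x) \<in> V" using p sV by (blast intro: subspace_scale)
    then show "p (c *\<^sub>R x) = c *\<^sub>R p x"
      using uniq[of "c *\<^sub>R p x" "c *\<^sub>R x"] p sW by (simp add: algebra_simps subspace_scale)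
  qed
  then show thesis using that p uniq by blast
qed

text \<open>With closed complements \<open>R\<close> of the kernel and \<open>N\<close> of the range, \<open>B y\<close> is the only \<open>r \<in> R\<close>
  with \<open>y - A r \<in> N\<close>. This description exhibits the graph of \<open>B\<close> as a closed set, so that no
  boundedness of the two projections has to be proved first.\<close>

lemma double_split_generalized_inverse:
  fixes A :: "'e::banach \<Rightarrow>\<^sub>L 'f::banach"
  assumes "A \<in> double_split"
  obtains B where "\<And>x. A (blinfun_apply B (A x)) = A x" "\<And>y. B (A (blinfun_apply B y)) = B y"
proof -
  obtain R N where R: "closed R" "complementary (null_space A) R"
    and N: "closed N" "complementary (range A) N"
    using assms unfolding double_split_def by blast
  obtain p where p: "linear p" "\<And>x. p x \<in> R" "\<And>x. x - p x \<in> null_space A"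
    "\<And>x w. w \<in> R \<Longrightarrow> x - w \<in> null_space A \<Longrightarrow> w = p x"
    using complementary_projection[OF R(2)] by blast
  obtain q where q: "linear q" "\<And>y. q y \<in> N" "\<And>y. y - q y \<in> range A"
    "\<And>y w. w \<in> N \<Longrightarrow> y - w \<in> range A \<Longrightarrow> w = q y"
    using complementary_projection[OF N(2)] by blast
  interpret p: linear p by (rule p(1))
  interpret q: linear q by (rule q(1))
  have sR: "subspace R" and sN: "subspace N" using R N by (auto simp: complementary_def)
  have Ap: "A (p x) = A x" for x using p(3)[of x] by (simp add: null_space_def blinfun.diff_right)
  have p_eq: "p x = p z" if "A x = A z" for x z
    using p(4)[of "p x" z] p(2) that by (simp add: null_space_def blinfun.diff_right Ap)
  have qA: "q (A x) = 0" for x using q(4)[of 0 "A x"] sN by (simp add: subspace_0)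
  have ex: "\<exists>r. r \<in> R \<and> A r = y - q y" for y using q(3)[of y] p(2) Ap by (metis imageE)
  then obtain b where b: "\<And>y. b y \<in> R" "\<And>y. A (b y) = y - q y" by metis
  have b_eq: "r = b y" if "r \<in> R" "y - A r \<in> N" for r y
  proof -
    have "q y = y - A r" using q(4)[of "y - A r" y] that by simp
    then have "A r = A (b y)" by (simp add: b)
    then have "p r = p (b y)" by (rule p_eq)
    moreover have "p s = s" if "s \<in> R" for s
      using p(4)[of s s] that by (simp add: null_space_def)
    ultimately show ?thesis using that b by simp
  qed
  have lin: "linear b"
  proof (rule linearI)
    fix x y and c :: real
    have "b x + b y \<in> R" "c *\<^sub>R b x \<in> R" using b sR by (auto intro: subspace_add subspace_scale)
    moreover have "x + y - A (b x + b y) \<in> N" "c *\<^sub>R x - A (c *\<^sub>R b x) \<in> N"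
      using q(2) sN by (auto simp: blinfun.bilinear_simps b algebra_simps subspace_add subspace_scale)
    ultimately show "b (x + y) = b x + b y" "b (c *\<^sub>R x) = c *\<^sub>R b x"
      using b_eq by (metis, metis)
  qed
  have "{(y, r). r = b y} = (UNIV \<times> R) \<inter> (\<lambda>(y, r). y - A r) -` N"
    using b b_eq q(2) by auto
  moreover have "closed \<dots>"
    unfolding split_beta
    by (intro closed_Int closed_Times closed_UNIV R closed_vimage N continuous_intros)
  ultimately have "bounded_linear b" by (intro closed_graph_bounded_linear lin) simp
  then have Bb: "blinfun_apply (Blinfun b) = b" by (rule bounded_linear_Blinfun_apply)
  show thesis
  proof
    show "A (Blinfun b (A x)) = A x" for x by (simp add: Bb b qA)
    show "Blinfun b (A (Blinfun b y)) = Blinfun b y" for y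
      using b_eq[of "b y" "A (b y)"] b(1) sN by (simp add: Bb subspace_0)
  qed
qed

section \<open>Inverses of operators close to an invertible one\<close>

definition is_inverse :: "('a::real_normed_vector \<Rightarrow>\<^sub>L 'b::real_normed_vector) \<Rightarrow> ('b \<Rightarrow>\<^sub>L 'a) \<Rightarrow> bool"
  where "is_inverse a w \<longleftrightarrow> a o\<^sub>L w = id_blinfun \<and> w o\<^sub>L a = id_blinfun"

definition invertibles :: "('a::real_normed_vector \<Rightarrow>\<^sub>L 'b::real_normed_vector) set"
  where "invertibles = {a. \<exists>w. is_inverse a w}"

definition op_inverse :: "('a::real_normed_vector \<Rightarrow>\<^sub>L 'b::real_normed_vector) \<Rightarrow> ('b \<Rightarrow>\<^sub>L 'a)"
  where "op_inverse a = (SOME w. is_inverse a w)"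

lemma is_inverseD:
  assumes "is_inverse a w"
  shows "blinfun_apply a (blinfun_apply w y) = y" "blinfun_apply w (blinfun_apply a x) = x"
proof -
  have "(a o\<^sub>L w) y = y" "(w o\<^sub>L a) x = x" using assms by (simp_all add: is_inverse_def)
  then show "blinfun_apply a (blinfun_apply w y) = y" "blinfun_apply w (blinfun_apply a x) = x" by simp_all
qed

lemma is_inverseI:
  assumes "\<And>y. blinfun_apply a (blinfun_apply w y) = y" "\<And>x. blinfun_apply w (blinfun_apply a x) = x"
  shows "is_inverse a w"
  using assms by (auto simp: is_inverse_def intro!: blinfun_eqI)

lemma is_inverse_unique:
  assumes "is_inverse a w" "is_inverse a w'"
  shows "w = w'"
  by (rule blinfun_eqI) (metis assms is_inverseD)

lemma op_inverse_eq: "is_inverse a w \<Longrightarrow> op_inverse a = w"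
  unfolding op_inverse_def by (metis is_inverse_unique someI)

lemma is_inverse_op_inverse: "a \<in> invertibles \<Longrightarrow> is_inverse a (op_inverse a)"
  unfolding invertibles_def using op_inverse_eq by blast

lemma norm_compose_le:
  "norm a \<le> \<alpha> \<Longrightarrow> norm b \<le> \<beta> \<Longrightarrow> norm (a o\<^sub>L b) \<le> \<alpha> * \<beta>"
  by (rule order_trans[OF norm_blinfun_compose mult_mono']) auto

text \<open>Solving \<open>x + d x = y\<close> is a fixed point problem for the contraction \<open>x \<mapsto> y - d x\<close>.\<close>

lemma neumann_inverse:
  fixes d :: "'x::banach \<Rightarrow>\<^sub>L 'x"
  assumes "norm d \<le> 1/2"
  obtains s where "is_inverse (id_blinfun + d) s" "norm s \<le> 2"
proof -
  have half: "norm (d x) \<le> norm x / 2" for x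
    using norm_blinfun[of d x] mult_right_mono[OF assms, of "norm x"] by simp
  have "\<exists>x. x + d x = y" for y
  proof -
    have "dist (y - d u) (y - d v) \<le> 1/2 * dist u v" for u v
      using half[of "u - v"] by (simp add: dist_norm norm_minus_commute blinfun.diff_right)
    then have "\<exists>!x. y - d x = x" by (intro banach_fix_type[of "1/2"]) auto
    then show ?thesis by (metis diff_add_cancel)
  qed
  then obtain r where r: "\<And>y. r y + d (r y) = y" by metis
  have lower: "norm x \<le> 2 * norm (x + d x)" for x
    using half[of x] norm_triangle_ineq2[of x "- d x"] by simp
  have uniq: "x = r y" if "x + d x = y" for x y
    using lower[of "x - r y"] r[of y] that by (simp add: blinfun.diff_right algebra_simps)
  have "bounded_linear r"
  proof (rule bounded_linear_intro[where K = 2])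
    show "r (x + y) = r x + r y" for x y
      by (rule uniq[symmetric]) (metis (no_types, lifting) r add.assoc add.commute blinfun.add_right)
    show "r (c *\<^sub>R x) = c *\<^sub>R r x" for c x
      by (rule uniq[symmetric]) (metis r blinfun.scaleR_right scaleR_add_right)
    show "norm (r x) \<le> norm x * 2" for x using lower[of "r x"] by (simp add: r)
  qed
  then have R: "blinfun_apply (Blinfun r) = r" by (rule bounded_linear_Blinfun_apply)
  show thesis
  proof
    show "is_inverse (id_blinfun + d) (Blinfun r)"
      by (rule is_inverseI) (simp_all add: R r blinfun.add_left uniq[symmetric])
    show "norm (Blinfun r) \<le> 2"
      by (rule norm_blinfun_bound) (use lower[of "r _"] in \<open>simp_all add: R r\<close>)
  qed
qed

text \<open>Factor \<open>a + h\<close> as \<open>a (I + w h)\<close>. The bound on the inverse is uniform in \<open>h\<close>, which is what the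
  estimates of the derivatives below depend on.\<close>

lemma perturbed_inverse:
  fixes a :: "'x::banach \<Rightarrow>\<^sub>L 'x"
  assumes "is_inverse a w" "norm w * norm h \<le> 1/2"
  obtains w' where "is_inverse (a + h) w'" "norm w' \<le> 2 * norm w"
proof -
  have "norm (w o\<^sub>L h) \<le> 1/2" using norm_blinfun_compose[of w h] assms(2) by linarith
  then obtain s where s: "is_inverse (id_blinfun + (w o\<^sub>L h)) s" "norm s \<le> 2"
    by (rule neumann_inverse)
  note [simp] = is_inverseD[OF assms(1)]
  have *: "(id_blinfun + (w o\<^sub>L h)) x = w ((a + h) x)" for x
    by (simp add: blinfun.bilinear_simps)
  have "is_inverse (a + h) (s o\<^sub>L w)"
  proof (rule is_inverseI)
    show "(s o\<^sub>L w) ((a + h) x) = x" for x using is_inverseD(2)[OF s(1), of x] by (simp add: *)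
    have "w ((a + h) ((s o\<^sub>L w) y)) = w y" for y
      using is_inverseD(1)[OF s(1), of "w y"] by (simp add: *)
    then show "(a + h) ((s o\<^sub>L w) y) = y" for y by (metis is_inverseD(1)[OF assms(1)])
  qed
  moreover have "norm (s o\<^sub>L w) \<le> 2 * norm w" using s(2) by (intro norm_compose_le) auto
  ultimately show thesis by (rule that)
qed

lemma half_bound: "0 \<le> t \<Longrightarrow> t * (1 / (2 * t + 1)) \<le> (1/2 :: real)"
  by (simp add: divide_le_eq)

lemma mult_le_of_le_divide:
  fixes e h N :: real
  assumes "0 \<le> N" "0 \<le> h" "h \<le> e / (N + 1)"
  shows "N * h \<le> e"
proof -
  have "N * h \<le> (N + 1) * h" using assms by (simp add: algebra_simps)
  also have "\<dots> \<le> e" using assms by (simp add: pos_le_divide_eq mult.commute)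
  finally show ?thesis .
qed

lemma open_invertibles: "open (invertibles :: ('x::banach \<Rightarrow>\<^sub>L 'x) set)"
proof (rule openI)
  fix a :: "'x \<Rightarrow>\<^sub>L 'x"
  assume "a \<in> invertibles"
  then obtain w where w: "is_inverse a w" by (auto simp: invertibles_def)
  define e where "e = 1 / (2 * norm w + 1)"
  have e: "e > 0" by (simp add: e_def add_nonneg_pos)
  have "b \<in> invertibles" if "b \<in> ball a e" for b
  proof -
    have "norm (b - a) \<le> e" using that by (simp add: dist_norm norm_minus_commute)
    then have "norm w * norm (b - a) \<le> norm w * e" by (intro mult_left_mono) auto
    also have "\<dots> \<le> 1/2" unfolding e_def by (rule half_bound) simp
    finally show ?thesis using perturbed_inverse[OF w, of "b - a"]
      by (metis (no_types, lifting) add.commute diff_add_cancel invertibles_def mem_Collect_eq)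
  qed
  then show "\<exists>e>0. ball a e \<subseteq> invertibles" using e by blast
qed

lemma resolvent_identity:
  assumes "is_inverse a w" "is_inverse (a + h) w'"
  shows "w' - w = - (w' o\<^sub>L h o\<^sub>L w)"
proof (rule blinfun_eqI)
  fix y
  have "w' ((a + h) (w y)) = w y" using is_inverseD(2)[OF assms(2)] .
  then show "(w' - w) y = (- (w' o\<^sub>L h o\<^sub>L w)) y"
    by (simp add: blinfun.bilinear_simps is_inverseD[OF assms(1)] algebra_simps)
qed

lemma resolvent_identity_second_order:
  assumes "w' - w = - (w' o\<^sub>L h o\<^sub>L w)"
  shows "w' - w + (w o\<^sub>L h o\<^sub>L w) = w' o\<^sub>L h o\<^sub>L w o\<^sub>L h o\<^sub>L w"
proof (rule blinfun_eqI)
  fix y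
  have *: "w' x - w x = - w' (h (w x))" for x
    using arg_cong[OF assms, of "\<lambda>f. blinfun_apply f x"] by (simp add: blinfun.bilinear_simps)
  have "(w' - w + (w o\<^sub>L h o\<^sub>L w)) y = - (w' (h (w y)) - w (h (w y)))"
    using *[of y] by (simp add: blinfun.bilinear_simps)
  also have "\<dots> = (w' o\<^sub>L h o\<^sub>L w o\<^sub>L h o\<^sub>L w) y"
    unfolding * by simp
  finally show "(w' - w + (w o\<^sub>L h o\<^sub>L w)) y = (w' o\<^sub>L h o\<^sub>L w o\<^sub>L h o\<^sub>L w) y" .
qed

lemma op_inverse_has_derivative:
  fixes a :: "'x::banach \<Rightarrow>\<^sub>L 'x"
  assumes w: "is_inverse a w"
  shows "(op_inverse has_derivative (\<lambda>h. - (w o\<^sub>L h o\<^sub>L w))) (at a)"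
  unfolding has_derivative_at_alt
proof (intro conjI allI impI)
  show "bounded_linear (\<lambda>h. - (w o\<^sub>L h o\<^sub>L w))"
    by (rule bounded_linear_minus) (intro bounded_linear_intros)
  fix e :: real assume e: "e > 0"
  define c where "c = 2 * norm w"
  define d where "d = min (1 / (c + 1)) (e / (c * c * c + 1))"
  have c: "c \<ge> 0" by (simp add: c_def)
  then have d: "d > 0" using e by (auto simp: d_def add_nonneg_pos)
  have "norm (op_inverse b - op_inverse a - - (w o\<^sub>L (b - a) o\<^sub>L w)) \<le> e * norm (b - a)"
    if "norm (b - a) < d" for b
  proof -
    define h where "h = b - a"
    have h: "norm h \<le> 1 / (c + 1)" "norm h \<le> e / (c * c * c + 1)"
      using that by (simp_all add: d_def h_def)
    have "norm w * norm h \<le> norm w * (1 / (c + 1))" using h by (intro mult_left_mono) auto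
    also have "\<dots> \<le> 1/2" unfolding c_def by (rule half_bound) simp
    finally obtain w' where w': "is_inverse (a + h) w'" "norm w' \<le> c"
      using perturbed_inverse[OF w] c_def by blast
    note eq = resolvent_identity_second_order[OF resolvent_identity[OF w w'(1)]]
    have "norm w \<le> c" by (simp add: c_def)
    then have "norm (w' o\<^sub>L h o\<^sub>L w o\<^sub>L h o\<^sub>L w) \<le> c * norm h * c * norm h * c"
      by (intro norm_compose_le w') auto
    also have "\<dots> = norm h * (c * c * c * norm h)" by simp
    also have "\<dots> \<le> norm h * e"
      using h c by (intro mult_left_mono mult_le_of_le_divide) auto
    finally show ?thesis
      using op_inverse_eq[OF w] op_inverse_eq[OF w'(1)] eq by (simp add: h_def mult.commute)
  qed
  then show "\<exists>d>0. \<forall>y. norm (y - a) < d \<longrightarrow>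
      norm (op_inverse y - op_inverse a - - (w o\<^sub>L (y - a) o\<^sub>L w)) \<le> e * norm (y - a)"
    using d by blast
qed

section \<open>Smoothness of operator inversion\<close>

text \<open>Differentiating \<open>a^-1\<close> in direction \<open>h\<close> gives \<open>- a^-1 h a^-1\<close>. By the product rule, the
  derivative of a word \<open>w v1 w v2 w \<dots> w\<close> in \<open>w = a^-1\<close> is minus the sum of the words that arise by
  inserting \<open>h\<close> at all possible places. Hence the \<open>k\<close>-th derivative of inversion is, up to the sign
  \<open>(-1)^k\<close>, the sum of the words over all orderings of the \<open>k\<close> directions. The orderings are
  permutations of indices rather than of the directions themselves, because linearity in the \<open>i\<close>-th
  direction is visible only when the position of the index \<open>i\<close> is known.\<close>

fun word :: "('x::real_normed_vector \<Rightarrow>\<^sub>L 'x) \<Rightarrow> ('x \<Rightarrow>\<^sub>L 'x) list \<Rightarrow> ('x \<Rightarrow>\<^sub>L 'x)" where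
  "word w [] = w"
| "word w (v # p) = w o\<^sub>L v o\<^sub>L word w p"

fun insertions :: "'a \<Rightarrow> 'a list \<Rightarrow> 'a list list" where
  "insertions h [] = [[h]]"
| "insertions h (v # p) = (h # v # p) # map ((#) v) (insertions h p)"

fun index_perms :: "nat \<Rightarrow> nat list list" where
  "index_perms 0 = [[]]"
| "index_perms (Suc k) = concat (map (\<lambda>p. insertions 0 (map Suc p)) (index_perms k))"

lemma mset_insertions: "q \<in> set (insertions h p) \<Longrightarrow> mset q = add_mset h (mset p)"
  by (induction p arbitrary: q) auto

lemma map_insertions: "map (map f) (insertions h p) = insertions (f h) (map f p)"
proof (induction p)
  case (Cons v p)
  have "map (map f) (map ((#) v) (insertions h p)) = map ((#) (f v)) (map (map f) (insertions h p))"
    by simp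
  then show ?case using Cons by (simp only: insertions.simps list.map)
qed simp

lemma mset_index_perms: "p \<in> set (index_perms k) \<Longrightarrow> mset p = mset [0..<k]"
proof (induction k arbitrary: p)
  case (Suc k)
  then obtain r where r: "r \<in> set (index_perms k)" "p \<in> set (insertions 0 (map Suc r))" by auto
  have "mset p = add_mset 0 (image_mset Suc (mset r))" using mset_insertions[OF r(2)] by simp
  also have "\<dots> = mset (0 # map Suc [0..<k])" using Suc.IH[OF r(1)] by simp
  also have "\<dots> = mset [0..<Suc k]" by (simp only: map_Suc_upt upt_conv_Cons[of 0 "Suc k"])
  finally show ?case .
qed simp

lemma prod_list_index_perms:
  fixes f :: "'a \<Rightarrow> real"
  assumes "p \<in> set (index_perms k)" "length vs = k"
  shows "(\<Prod>v\<leftarrow>map (nth vs) p. f v) = (\<Prod>v\<leftarrow>vs. f v)"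
proof -
  have "mset (map (nth vs) p) = image_mset (nth vs) (mset p)" by simp
  also have "\<dots> = mset (map (nth vs) [0..<length vs])"
    unfolding mset_index_perms[OF assms(1)] assms(2) by simp
  also have "\<dots> = mset vs" by (simp only: map_nth)
  finally have "mset (map f (map (nth vs) p)) = mset (map f vs)" by (metis mset_map)
  then show ?thesis by (metis prod_mset_prod_list)
qed

text \<open>Passing from order \<open>k\<close> to order \<open>k + 1\<close> inserts the new direction into every word, which is
  exactly the product rule.\<close>

lemma sum_list_index_perms_Suc:
  "(\<Sum>p\<leftarrow>index_perms (Suc k). f (map (nth (h # vs)) p)) =
   (\<Sum>p\<leftarrow>index_perms k. \<Sum>q\<leftarrow>insertions h (map (nth vs) p). f q)"
proof -
  have *: "map (map (nth (h # vs))) (insertions 0 (map Suc p)) = insertions h (map (nth vs) p)" for p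
    by (simp add: map_insertions comp_def)
  have "map (\<lambda>p. f (map (nth (h # vs)) p)) (insertions 0 (map Suc p))
      = map f (insertions h (map (nth vs) p))" for p
    unfolding *[symmetric] by simp
  then have "(\<Sum>p\<leftarrow>concat (map (\<lambda>p. insertions 0 (map Suc p)) ps). f (map (nth (h # vs)) p)) =
     (\<Sum>p\<leftarrow>ps. \<Sum>q\<leftarrow>insertions h (map (nth vs) p). f q)" for ps
    by (induction ps) (simp_all del: map_map)
  then show ?thesis by simp
qed

lemma linear_sum_list:
  assumes "\<And>p. p \<in> set ps \<Longrightarrow> linear (F p)"
  shows "linear (\<lambda>h. \<Sum>p\<leftarrow>ps. F p h)"
  using assms
  by (induction ps) (auto intro: linear_zero linear_compose_add)

lemma norm_sum_list_le:
  fixes F :: "'p \<Rightarrow> 'a::real_normed_vector"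
  assumes "\<And>p. p \<in> set ps \<Longrightarrow> norm (F p) \<le> c"
  shows "norm (\<Sum>p\<leftarrow>ps. F p) \<le> real (length ps) * c"
  using assms
proof (induction ps)
  case (Cons p ps)
  then have "norm (F p) \<le> c" "norm (\<Sum>p\<leftarrow>ps. F p) \<le> real (length ps) * c" by auto
  then show ?case using norm_triangle_ineq[of "F p" "\<Sum>p\<leftarrow>ps. F p"] by (simp add: algebra_simps)
qed simp

lemma norm_word_le:
  "norm w \<le> c \<Longrightarrow> norm (word w p) \<le> c ^ Suc (length p) * (\<Prod>v\<leftarrow>p. norm v)"
proof (induction p)
  case (Cons v p)
  then have "norm (word w (v # p)) \<le> c * norm v * (c ^ Suc (length p) * (\<Prod>v\<leftarrow>p. norm v))"
    by (auto intro!: norm_compose_le)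
  then show ?case by (simp add: mult_ac)
qed simp

lemma compose_sum_list: "a o\<^sub>L (\<Sum>q\<leftarrow>qs. F q) = (\<Sum>q\<leftarrow>qs. a o\<^sub>L F q)"
  by (induction qs) (auto simp: bounded_bilinear.add_right[OF bounded_bilinear_blinfun_compose])

text \<open>The two resolvents enter only through the resolvent identity and a common bound \<open>c\<close>, so that the
  constant depends on nothing but \<open>c\<close> and the length of the word; it is then uniform in the
  directions.\<close>

lemma word_difference_bound:
  "\<exists>K\<ge>0. \<forall>w w' h p. norm w \<le> c \<longrightarrow> norm w' \<le> c \<longrightarrow> w' - w = - (w' o\<^sub>L h o\<^sub>L w) \<longrightarrow>
     length p = k \<longrightarrow> norm (word w' p - word w p) \<le> K * norm h * (\<Prod>v\<leftarrow>p. norm v)"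
proof (cases "c \<ge> 0")
  case False
  then have "\<not> norm w \<le> c" for w :: "'a \<Rightarrow>\<^sub>L 'a"
    by (meson norm_ge_zero order_trans)
  then show ?thesis by (intro exI[of _ 0]) auto
next
  case c: True
  show ?thesis
  proof (induction k)
    case 0
    have "norm (word w' p - word w p) \<le> (c * c) * norm h * (\<Prod>v\<leftarrow>p. norm v)"
      if "norm w \<le> c" "norm w' \<le> c" "w' - w = - (w' o\<^sub>L h o\<^sub>L w)" "length p = 0" for w w' h :: "'a \<Rightarrow>\<^sub>L 'a" and p
    proof -
      have "norm (w' o\<^sub>L h o\<^sub>L w) \<le> c * norm h * c" using that by (intro norm_compose_le) auto
      then show ?thesis using that by (simp add: mult_ac)
    qed
    then show ?case using c by (intro exI[of _ "c * c"]) auto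
  next
    case (Suc k)
    then obtain K where K: "K \<ge> 0" "\<And>(w :: 'a \<Rightarrow>\<^sub>L 'a) w' h p. norm w \<le> c \<Longrightarrow> norm w' \<le> c \<Longrightarrow>
        w' - w = - (w' o\<^sub>L h o\<^sub>L w) \<Longrightarrow> length p = k \<Longrightarrow>
        norm (word w' p - word w p) \<le> K * norm h * (\<Prod>v\<leftarrow>p. norm v)" by blast
    have "norm (word w' p - word w p) \<le> (c * c * c ^ Suc k + c * K) * norm h * (\<Prod>v\<leftarrow>p. norm v)"
      if w: "norm w \<le> c" "norm w' \<le> c" and w': "w' - w = - (w' o\<^sub>L h o\<^sub>L w)" and "length p = Suc k"
      for w w' h :: "'a \<Rightarrow>\<^sub>L 'a" and p
    proof -
      obtain v q where p: "p = v # q" "length q = k" using \<open>length p = Suc k\<close> by (cases p) auto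
      define b b' where bd: "b = word w q" "b' = word w' q"
      let ?P = "\<Prod>v\<leftarrow>q. norm v"
      have nd: "norm (w' - w) \<le> c * norm h * c"
        unfolding w' norm_minus_cancel using w by (intro norm_compose_le) auto
      have nb': "norm b' \<le> c ^ Suc k * ?P" using norm_word_le[OF w(2), of q] p by (simp add: bd)
      have nbb: "norm (b' - b) \<le> K * norm h * ?P" unfolding bd by (rule K(2)[OF w w' p(2)])
      have "word w' p - word w p = ((w' - w) o\<^sub>L v o\<^sub>L b') + (w o\<^sub>L v o\<^sub>L (b' - b))"
        by (rule blinfun_eqI) (simp add: p bd blinfun.bilinear_simps)
      also have "norm \<dots> \<le> norm ((w' - w) o\<^sub>L v o\<^sub>L b') + norm (w o\<^sub>L v o\<^sub>L (b' - b))"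
        by (rule norm_triangle_ineq)
      also have "\<dots> \<le> c * norm h * c * norm v * (c ^ Suc k * ?P) + c * norm v * (K * norm h * ?P)"
        by (intro add_mono norm_compose_le nd nb' nbb w) auto
      also have "\<dots> = (c * c * c ^ Suc k + c * K) * norm h * (\<Prod>v\<leftarrow>p. norm v)"
        by (simp add: p algebra_simps)
      finally show ?thesis .
    qed
    then show ?case using c K(1) by (intro exI[of _ "c * c * c ^ Suc k + c * K"]) auto
  qed
qed

text \<open>Taylor's formula to second order for words. A quadratic remainder, in contrast to one that is
  merely small compared with \<open>norm h\<close>, passes through the induction on the length.\<close>

lemma word_second_order_bound:
  assumes c: "c \<ge> 0"
  shows "\<exists>K\<ge>0. \<forall>w w' h p. norm w \<le> c \<longrightarrow> norm w' \<le> c \<longrightarrow> w' - w = - (w' o\<^sub>L h o\<^sub>L w) \<longrightarrow>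
     length p = k \<longrightarrow> norm (word w' p - word w p + (\<Sum>q\<leftarrow>insertions h p. word w q))
        \<le> K * norm h ^ 2 * (\<Prod>v\<leftarrow>p. norm v)"
proof -
  have base: "norm (w' - w + (w o\<^sub>L h o\<^sub>L w)) \<le> c * norm h * c * norm h * c"
    if w: "norm w \<le> c" "norm w' \<le> c" and w': "w' - w = - (w' o\<^sub>L h o\<^sub>L w)"
    for w w' h :: "'a \<Rightarrow>\<^sub>L 'a"
  proof -
    show ?thesis unfolding resolvent_identity_second_order[OF w']
      using w by (auto intro!: norm_compose_le)
  qed
  show ?thesis
  proof (induction k)
    case 0
    have "norm (word w' p - word w p + (\<Sum>q\<leftarrow>insertions h p. word w q))
        \<le> (c * c * c) * norm h ^ 2 * (\<Prod>v\<leftarrow>p. norm v)"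
      if "norm w \<le> c" "norm w' \<le> c" "w' - w = - (w' o\<^sub>L h o\<^sub>L w)" "length p = 0"
      for w w' h :: "'a \<Rightarrow>\<^sub>L 'a" and p
      using base[OF that(1-3)] that(4) by (simp add: power2_eq_square mult_ac)
    then show ?case using c by (intro exI[of _ "c * c * c"]) auto
  next
    case (Suc k)
    then obtain K where K: "K \<ge> 0" "\<And>(w :: 'a \<Rightarrow>\<^sub>L 'a) w' h p. norm w \<le> c \<Longrightarrow> norm w' \<le> c \<Longrightarrow>
        w' - w = - (w' o\<^sub>L h o\<^sub>L w) \<Longrightarrow> length p = k \<Longrightarrow>
        norm (word w' p - word w p + (\<Sum>q\<leftarrow>insertions h p. word w q))
          \<le> K * norm h ^ 2 * (\<Prod>v\<leftarrow>p. norm v)" by blast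
    obtain L where L: "L \<ge> 0" "\<And>(w :: 'a \<Rightarrow>\<^sub>L 'a) w' h p. norm w \<le> c \<Longrightarrow> norm w' \<le> c \<Longrightarrow>
        w' - w = - (w' o\<^sub>L h o\<^sub>L w) \<Longrightarrow> length p = k \<Longrightarrow>
        norm (word w' p - word w p) \<le> L * norm h * (\<Prod>v\<leftarrow>p. norm v)"
      using word_difference_bound[of c k] by blast
    let ?K = "c * c * c * c ^ Suc k + c * c * L + c * K"
    have "norm (word w' p - word w p + (\<Sum>q\<leftarrow>insertions h p. word w q))
        \<le> ?K * norm h ^ 2 * (\<Prod>v\<leftarrow>p. norm v)"
      if w: "norm w \<le> c" "norm w' \<le> c" and w': "w' - w = - (w' o\<^sub>L h o\<^sub>L w)" and "length p = Suc k"
      for w w' h :: "'a \<Rightarrow>\<^sub>L 'a" and p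
    proof -
      obtain v q where p: "p = v # q" "length q = k" using \<open>length p = Suc k\<close> by (cases p) auto
      define b b' s where bd: "b = word w q" "b' = word w' q" "s = (\<Sum>q\<leftarrow>insertions h q. word w q)"
      let ?P = "\<Prod>v\<leftarrow>q. norm v"
      have nb': "norm b' \<le> c ^ Suc k * ?P" using norm_word_le[OF w(2), of q] p by (simp add: bd)
      have n1: "norm (b' - b) \<le> L * norm h * ?P" unfolding bd by (rule L(2)[OF w w' p(2)])
      have n2: "norm (b' - b + s) \<le> K * norm h ^ 2 * ?P" unfolding bd by (rule K(2)[OF w w' p(2)])
      \<comment> \<open>The remainder splits into the one of the first letter, a product of two first differences,
        and the one of the shorter word.\<close>
      have "(\<Sum>q\<leftarrow>insertions h p. word w q) = (w o\<^sub>L h o\<^sub>L (w o\<^sub>L v o\<^sub>L b)) + (w o\<^sub>L v o\<^sub>L s)"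
        by (simp add: p bd comp_def compose_sum_list)
      then have "word w' p - word w p + (\<Sum>q\<leftarrow>insertions h p. word w q) =
          ((w' - w + (w o\<^sub>L h o\<^sub>L w)) o\<^sub>L v o\<^sub>L b') - (w o\<^sub>L h o\<^sub>L w o\<^sub>L v o\<^sub>L (b' - b))
            + (w o\<^sub>L v o\<^sub>L (b' - b + s))"
        by (intro blinfun_eqI) (simp add: p bd(1,2) blinfun.bilinear_simps)
      also have "norm \<dots> \<le> norm ((w' - w + (w o\<^sub>L h o\<^sub>L w)) o\<^sub>L v o\<^sub>L b')
          + norm (w o\<^sub>L h o\<^sub>L w o\<^sub>L v o\<^sub>L (b' - b)) + norm (w o\<^sub>L v o\<^sub>L (b' - b + s))"
        by (intro order_trans[OF norm_triangle_ineq] add_mono norm_triangle_ineq4 order_refl)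
      also have "\<dots> \<le> c * norm h * c * norm h * c * norm v * (c ^ Suc k * ?P)
          + c * norm h * c * norm v * (L * norm h * ?P) + c * norm v * (K * norm h ^ 2 * ?P)"
        by (intro add_mono norm_compose_le base nb' n1 n2 w w') auto
      also have "\<dots> = ?K * norm h ^ 2 * (\<Prod>v\<leftarrow>p. norm v)"
        by (simp add: p algebra_simps power2_eq_square)
      finally show ?thesis .
    qed
    then show ?case using c K(1) L(1) by (intro exI[of _ ?K]) auto
  qed
qed

definition inverse_deriv :: "('x::real_normed_vector \<Rightarrow>\<^sub>L 'x) \<Rightarrow> ('x \<Rightarrow>\<^sub>L 'x) list \<Rightarrow> ('x \<Rightarrow>\<^sub>L 'x)"
  where "inverse_deriv w vs =
    (-1) ^ length vs *\<^sub>R (\<Sum>p\<leftarrow>index_perms (length vs). word w (map (nth vs) p))"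

lemma linear_word_slot:
  assumes "distinct p" "set p \<subseteq> {..<length vs}" "i \<in> set p"
  shows "linear (\<lambda>h. word w (map (nth (vs[i := h])) p))"
  using assms
proof (induction p)
  case (Cons j p)
  have left: "linear (\<lambda>h. a o\<^sub>L h o\<^sub>L b)" for a b :: "'a \<Rightarrow>\<^sub>L 'a"
    by (intro bounded_linear.linear bounded_linear_intros)
  have right: "linear (\<lambda>h. a o\<^sub>L h)" for a :: "'a \<Rightarrow>\<^sub>L 'a"
    by (intro bounded_linear.linear bounded_linear_intros)
  show ?case
  proof (cases "j = i")
    case True
    then have *: "map (nth (vs[i := h])) p = map (nth vs) p" for h
      using Cons.prems by (auto intro!: nth_list_update_neq)
    show ?thesis using True Cons.prems left by (simp add: *)
  next
    case False
    then have "linear (\<lambda>h. word w (map (nth (vs[i := h])) p))" using Cons by auto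
    from linear_compose[OF this right[of "w o\<^sub>L vs ! j"]]
    show ?thesis using False by (simp add: comp_def)
  qed
qed simp

lemma bounded_multilinear_inverse_deriv: "bounded_multilinear k (inverse_deriv w)"
  unfolding bounded_multilinear_def
proof (intro conjI allI impI)
  fix vs :: "('a \<Rightarrow>\<^sub>L 'a) list" and i
  assume k: "length vs = k \<and> i < k"
  have "linear (\<lambda>h. word w (map (nth (vs[i := h])) p))" if "p \<in> set (index_perms k)" for p
    using mset_index_perms[OF that] k mset_eq_setD[of p "[0..<k]"] mset_eq_imp_distinct_iff[of p "[0..<k]"]
    by (intro linear_word_slot) auto
  then have "linear (\<lambda>h. \<Sum>p\<leftarrow>index_perms k. word w (map (nth (vs[i := h])) p))"
    by (rule linear_sum_list)
  then show "linear (\<lambda>h. inverse_deriv w (vs[i := h]))"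
    using k by (simp add: inverse_deriv_def linear_compose_scale_right)
next
  let ?K = "real (length (index_perms k)) * norm w ^ Suc k"
  have "norm (inverse_deriv w vs) \<le> ?K * (\<Prod>v\<leftarrow>vs. norm v)" if k: "length vs = k" for vs
  proof -
    have "norm (word w (map (nth vs) p)) \<le> norm w ^ Suc k * (\<Prod>v\<leftarrow>vs. norm v)"
      if "p \<in> set (index_perms k)" for p
    proof -
      have "length p = k" using mset_index_perms[OF that] by (metis length_upt minus_nat.diff_0 size_mset)
      then show ?thesis
        using norm_word_le[of w "norm w" "map (nth vs) p"] prod_list_index_perms[OF that k, of norm] by simp
    qed
    then have "norm (\<Sum>p\<leftarrow>index_perms k. word w (map (nth vs) p))
        \<le> real (length (index_perms k)) * (norm w ^ Suc k * (\<Prod>v\<leftarrow>vs. norm v))"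
      by (rule norm_sum_list_le)
    then show ?thesis using k by (simp add: inverse_deriv_def mult_ac)
  qed
  then show "\<exists>K. \<forall>vs. length vs = k \<longrightarrow> norm (inverse_deriv w vs) \<le> K * (\<Prod>v\<leftarrow>vs. norm v)" by blast
qed

theorem cinfinity_on_op_inverse:
  "cinfinity_on (invertibles :: ('x::banach \<Rightarrow>\<^sub>L 'x) set) op_inverse"
  unfolding cinfinity_on_def
proof (intro exI[of _ "\<lambda>a. inverse_deriv (op_inverse a)"] ballI conjI allI impI)
  fix a :: "'x \<Rightarrow>\<^sub>L 'x"
  assume "a \<in> invertibles"
  then have w: "is_inverse a (op_inverse a)" by (rule is_inverse_op_inverse)
  show "inverse_deriv (op_inverse a) [] = op_inverse a" by (simp add: inverse_deriv_def)
  show "bounded_multilinear k (inverse_deriv (op_inverse a))" for k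
    by (rule bounded_multilinear_inverse_deriv)
  fix k :: nat and e :: real
  assume e: "e > 0"
  define w where "w = op_inverse a"
  have w: "is_inverse a w" using w by (simp add: w_def)
  define c where "c = 2 * norm w"
  have c: "c \<ge> 0" by (simp add: c_def)
  obtain K where K: "K \<ge> 0" "\<And>(w :: 'x \<Rightarrow>\<^sub>L 'x) w' h p. norm w \<le> c \<Longrightarrow> norm w' \<le> c \<Longrightarrow>
        w' - w = - (w' o\<^sub>L h o\<^sub>L w) \<Longrightarrow> length p = k \<Longrightarrow>
        norm (word w' p - word w p + (\<Sum>q\<leftarrow>insertions h p. word w q))
          \<le> K * norm h ^ 2 * (\<Prod>v\<leftarrow>p. norm v)"
    using word_second_order_bound[OF c, of k] by blast
  define N where "N = real (length (index_perms k)) * K"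
  have N: "N \<ge> 0" using K by (simp add: N_def)
  define d where "d = min (1 / (c + 1)) (e / (N + 1))"
  have d: "d > 0" using e c N by (auto simp: d_def add_nonneg_pos)
  have "norm (inverse_deriv (op_inverse (a + h)) vs - inverse_deriv w vs - inverse_deriv w (h # vs))
      \<le> e * norm h * (\<Prod>v\<leftarrow>vs. norm v)" if h: "norm h < d" and k: "length vs = k" for h vs
  proof -
    have h: "norm h \<le> 1 / (c + 1)" "norm h \<le> e / (N + 1)" using h by (simp_all add: d_def)
    have "norm w * norm h \<le> norm w * (1 / (c + 1))" using h by (intro mult_left_mono) auto
    also have "\<dots> \<le> 1/2" unfolding c_def by (rule half_bound) simp
    finally obtain w' where w': "is_inverse (a + h) w'" "norm w' \<le> c"
      using perturbed_inverse[OF w] c_def by blast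
    have nw: "norm w \<le> c" by (simp add: c_def)
    let ?P = "\<Prod>v\<leftarrow>vs. norm v"
    let ?r = "\<lambda>p. word w' p - word w p + (\<Sum>q\<leftarrow>insertions h p. word w q)"
    have P: "?P \<ge> 0" by (induction vs) auto
    have "norm (?r (map (nth vs) p)) \<le> K * norm h ^ 2 * ?P" if "p \<in> set (index_perms k)" for p
    proof -
      have "length p = k" using mset_index_perms[OF that] by (metis length_upt minus_nat.diff_0 size_mset)
      then show ?thesis
        using K(2)[OF nw w'(2) resolvent_identity[OF w w'(1)], of "map (nth vs) p"]
          prod_list_index_perms[OF that k, of norm] by simp
    qed
    then have "norm (\<Sum>p\<leftarrow>index_perms k. ?r (map (nth vs) p))
        \<le> real (length (index_perms k)) * (K * norm h ^ 2 * ?P)"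
      by (rule norm_sum_list_le)
    also have "\<dots> = (N * norm h) * (norm h * ?P)" by (simp add: N_def power2_eq_square)
    also have "\<dots> \<le> e * (norm h * ?P)"
      using h N P by (intro mult_right_mono mult_le_of_le_divide) auto
    finally have *: "norm (\<Sum>p\<leftarrow>index_perms k. ?r (map (nth vs) p)) \<le> e * norm h * ?P"
      by (simp add: mult.assoc)
    have "inverse_deriv w' vs - inverse_deriv w vs - inverse_deriv w (h # vs)
        = (-1) ^ k *\<^sub>R (\<Sum>p\<leftarrow>index_perms k. ?r (map (nth vs) p))"
    proof -
      have 1: "inverse_deriv w (h # vs) = - ((-1) ^ k *\<^sub>R
          (\<Sum>p\<leftarrow>index_perms k. \<Sum>q\<leftarrow>insertions h (map (nth vs) p). word w q))"
        unfolding inverse_deriv_def using sum_list_index_perms_Suc[of "word w" h vs k] k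
        by simp
      show ?thesis unfolding 1
        by (simp add: inverse_deriv_def k sum_list_addf sum_list_subtractf algebra_simps)
    qed
    then show ?thesis using * op_inverse_eq[OF w'(1)] by simp
  qed
  then show "\<exists>\<delta>>0. \<forall>h. norm h < \<delta> \<and> a + h \<in> invertibles \<longrightarrow> (\<forall>vs. length vs = k \<longrightarrow>
      norm (inverse_deriv (op_inverse (a + h)) vs - inverse_deriv (op_inverse a) vs
        - inverse_deriv (op_inverse a) (h # vs)) \<le> e * norm h * (\<Prod>v\<leftarrow>vs. norm v))"
    using d unfolding w_def by blast
qed

section \<open>Operations preserving smoothness\<close>

lemma prod_list_norm_nonneg: "0 \<le> (\<Prod>v\<leftarrow>vs. norm v)"
  by (induction vs) auto

lemma cinfinity_on_cong:
  assumes "cinfinity_on U f" "\<And>x. x \<in> U \<Longrightarrow> f x = g x"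
  shows "cinfinity_on U g"
  using assms unfolding cinfinity_on_def by metis

lemma cinfinity_on_ident: "cinfinity_on U (\<lambda>x. x)"
proof -
  define D :: "'a \<Rightarrow> 'a list \<Rightarrow> 'a"
    where "D x vs = (case vs of [] \<Rightarrow> x | [v] \<Rightarrow> v | _ \<Rightarrow> 0)" for x vs
  have "bounded_multilinear k (D x)" for k x
  proof -
    consider "k = 0" | "k = 1" | j where "k = Suc (Suc j)" by (metis One_nat_def old.nat.exhaust)
    then show ?thesis
    proof cases
      case 1
      then show ?thesis by (auto simp: bounded_multilinear_def D_def)
    next
      case 2
      have "D x (vs[i := h]) = h" if "length vs = 1" "i < 1" for vs i h
        using that by (auto simp: length_Suc_conv D_def)
      moreover have "norm (D x vs) \<le> 1 * (\<Prod>v\<leftarrow>vs. norm v)" if "length vs = 1" for vs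
        using that by (auto simp: length_Suc_conv D_def)
      ultimately show ?thesis unfolding 2 bounded_multilinear_def
        using linear_ident by (metis (no_types, lifting) ext)
    next
      case 3
      have "D x vs = 0" if "length vs = k" for vs
        using that 3 by (auto simp: length_Suc_conv D_def)
      then show ?thesis by (auto simp: bounded_multilinear_def linear_zero intro!: exI[of _ 0])
    qed
  qed
  moreover have "norm (D (x + h) vs - D x vs - D x (h # vs)) \<le> e * norm h * (\<Prod>v\<leftarrow>vs. norm v)"
    if "e > 0" for e x h and vs :: "'a list"
  proof -
    have "D (x + h) vs - D x vs - D x (h # vs) = 0" by (simp add: D_def split: list.split)
    then show ?thesis using that prod_list_norm_nonneg[of vs] by simp
  qed
  moreover have "D x [] = x" for x by (simp add: D_def)
  ultimately show ?thesis
    unfolding cinfinity_on_def by (intro exI[of _ D] ballI conjI allI impI exI[of _ "1 :: real"]) auto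
qed

lemma cinfinity_on_add:
  assumes "cinfinity_on U f" "cinfinity_on U g"
  shows "cinfinity_on U (\<lambda>x. f x + g x)"
proof -
  obtain Df where f: "\<And>x. x \<in> U \<Longrightarrow> Df x [] = f x" "\<And>x k. x \<in> U \<Longrightarrow> bounded_multilinear k (Df x)"
    "\<And>x k e. x \<in> U \<Longrightarrow> e > 0 \<Longrightarrow> \<exists>d>0. \<forall>h. norm h < d \<and> x + h \<in> U \<longrightarrow> (\<forall>vs. length vs = k \<longrightarrow>
        norm (Df (x + h) vs - Df x vs - Df x (h # vs)) \<le> e * norm h * (\<Prod>v\<leftarrow>vs. norm v))"
    using assms(1) unfolding cinfinity_on_def by blast
  obtain Dg where g: "\<And>x. x \<in> U \<Longrightarrow> Dg x [] = g x" "\<And>x k. x \<in> U \<Longrightarrow> bounded_multilinear k (Dg x)"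
    "\<And>x k e. x \<in> U \<Longrightarrow> e > 0 \<Longrightarrow> \<exists>d>0. \<forall>h. norm h < d \<and> x + h \<in> U \<longrightarrow> (\<forall>vs. length vs = k \<longrightarrow>
        norm (Dg (x + h) vs - Dg x vs - Dg x (h # vs)) \<le> e * norm h * (\<Prod>v\<leftarrow>vs. norm v))"
    using assms(2) unfolding cinfinity_on_def by blast
  show ?thesis
    unfolding cinfinity_on_def
  proof (intro exI[of _ "\<lambda>x vs. Df x vs + Dg x vs"] ballI conjI allI impI)
    fix x assume x: "x \<in> U"
    show "Df x [] + Dg x [] = f x + g x" using f g x by simp
    show "bounded_multilinear k (\<lambda>vs. Df x vs + Dg x vs)" for k
    proof -
      obtain K L where K: "\<And>vs. length vs = k \<Longrightarrow> norm (Df x vs) \<le> K * (\<Prod>v\<leftarrow>vs. norm v)"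
        and L: "\<And>vs. length vs = k \<Longrightarrow> norm (Dg x vs) \<le> L * (\<Prod>v\<leftarrow>vs. norm v)"
        using f(2)[OF x, of k] g(2)[OF x, of k] unfolding bounded_multilinear_def by blast
      have "norm (Df x vs + Dg x vs) \<le> (K + L) * (\<Prod>v\<leftarrow>vs. norm v)" if "length vs = k" for vs
        using norm_triangle_le[OF add_mono[OF K[OF that] L[OF that]]] by (simp add: distrib_right)
      moreover have "linear (\<lambda>h. Df x (vs[i := h]) + Dg x (vs[i := h]))" if "length vs = k \<and> i < k" for vs i
        using f(2)[OF x, of k] g(2)[OF x, of k] that unfolding bounded_multilinear_def
        by (intro linear_compose_add) blast+
      ultimately show ?thesis unfolding bounded_multilinear_def by blast
    qed
    fix k and e :: real assume "e > 0"
    then have "e / 2 > 0" by simp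
    obtain d1 where d1: "d1 > 0" "\<And>h vs. norm h < d1 \<Longrightarrow> x + h \<in> U \<Longrightarrow> length vs = k \<Longrightarrow>
        norm (Df (x + h) vs - Df x vs - Df x (h # vs)) \<le> e / 2 * norm h * (\<Prod>v\<leftarrow>vs. norm v)"
      using f(3)[OF x \<open>e / 2 > 0\<close>, of k] by blast
    obtain d2 where d2: "d2 > 0" "\<And>h vs. norm h < d2 \<Longrightarrow> x + h \<in> U \<Longrightarrow> length vs = k \<Longrightarrow>
        norm (Dg (x + h) vs - Dg x vs - Dg x (h # vs)) \<le> e / 2 * norm h * (\<Prod>v\<leftarrow>vs. norm v)"
      using g(3)[OF x \<open>e / 2 > 0\<close>, of k] by blast
    have "norm (Df (x + h) vs + Dg (x + h) vs - (Df x vs + Dg x vs) - (Df x (h # vs) + Dg x (h # vs)))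
        \<le> e * norm h * (\<Prod>v\<leftarrow>vs. norm v)"
      if "norm h < min d1 d2" "x + h \<in> U" "length vs = k" for h vs
    proof -
      have "norm ((Df (x + h) vs - Df x vs - Df x (h # vs)) + (Dg (x + h) vs - Dg x vs - Dg x (h # vs)))
          \<le> e / 2 * norm h * (\<Prod>v\<leftarrow>vs. norm v) + e / 2 * norm h * (\<Prod>v\<leftarrow>vs. norm v)"
        using that by (intro norm_triangle_le add_mono d1 d2) auto
      then show ?thesis by (simp add: algebra_simps)
    qed
    then show "\<exists>d>0. \<forall>h. norm h < d \<and> x + h \<in> U \<longrightarrow> (\<forall>vs. length vs = k \<longrightarrow>
        norm (Df (x + h) vs + Dg (x + h) vs - (Df x vs + Dg x vs) - (Df x (h # vs) + Dg x (h # vs)))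
          \<le> e * norm h * (\<Prod>v\<leftarrow>vs. norm v))"
      using d1(1) d2(1) by (intro exI[of _ "min d1 d2"]) auto
  qed
qed

lemma cinfinity_on_bounded_linear_image:
  assumes J: "bounded_linear J" and f: "cinfinity_on U f"
  shows "cinfinity_on U (\<lambda>x. J (f x))"
proof -
  interpret J: bounded_linear J by (rule J)
  obtain L where L: "L > 0" "\<And>y. norm (J y) \<le> norm y * L" using J.pos_bounded by blast
  obtain D where f: "\<And>x. x \<in> U \<Longrightarrow> D x [] = f x" "\<And>x k. x \<in> U \<Longrightarrow> bounded_multilinear k (D x)"
    "\<And>x k e. x \<in> U \<Longrightarrow> e > 0 \<Longrightarrow> \<exists>d>0. \<forall>h. norm h < d \<and> x + h \<in> U \<longrightarrow> (\<forall>vs. length vs = k \<longrightarrow>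
        norm (D (x + h) vs - D x vs - D x (h # vs)) \<le> e * norm h * (\<Prod>v\<leftarrow>vs. norm v))"
    using f unfolding cinfinity_on_def by blast
  have JL: "norm (J y) \<le> a * L * b" if "norm y \<le> a * b" for y a b
  proof -
    have "norm (J y) \<le> a * b * L"
      using L(1) that by (intro order_trans[OF L(2)] mult_right_mono) auto
    then show ?thesis by (simp add: mult_ac)
  qed
  show ?thesis
    unfolding cinfinity_on_def
  proof (intro exI[of _ "\<lambda>x vs. J (D x vs)"] ballI conjI allI impI)
    fix x assume x: "x \<in> U"
    show "J (D x []) = J (f x)" using f x by simp
    show "bounded_multilinear k (\<lambda>vs. J (D x vs))" for k
    proof -
      have lin: "linear (\<lambda>h. D x (vs[i := h]))" if "length vs = k \<and> i < k" for vs i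
        using f(2)[OF x, of k] that unfolding bounded_multilinear_def by blast
      obtain K where "\<And>vs. length vs = k \<Longrightarrow> norm (D x vs) \<le> K * (\<Prod>v\<leftarrow>vs. norm v)"
        using f(2)[OF x, of k] unfolding bounded_multilinear_def by blast
      then have "norm (J (D x vs)) \<le> (K * L) * (\<Prod>v\<leftarrow>vs. norm v)" if "length vs = k" for vs
        using that by (intro JL)
      then show ?thesis
        using linear_compose[OF lin J.linear] unfolding bounded_multilinear_def comp_def by blast
    qed
    fix k and e :: real assume e: "e > 0"
    then have "e / L > 0" using L by simp
    from f(3)[OF x this, of k] obtain d where d: "d > 0"
      "\<And>h vs. norm h < d \<Longrightarrow> x + h \<in> U \<Longrightarrow> length vs = k \<Longrightarrow>
        norm (D (x + h) vs - D x vs - D x (h # vs)) \<le> e / L * norm h * (\<Prod>v\<leftarrow>vs. norm v)"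
      by blast
    have "norm (J (D (x + h) vs) - J (D x vs) - J (D x (h # vs))) \<le> e * norm h * (\<Prod>v\<leftarrow>vs. norm v)"
      if "norm h < d" "x + h \<in> U" "length vs = k" for h vs
      using JL[OF d(2)[OF that]] L(1) by (simp add: J.diff)
    then show "\<exists>d>0. \<forall>h. norm h < d \<and> x + h \<in> U \<longrightarrow> (\<forall>vs. length vs = k \<longrightarrow>
        norm (J (D (x + h) vs) - J (D x vs) - J (D x (h # vs))) \<le> e * norm h * (\<Prod>v\<leftarrow>vs. norm v))"
      using d(1) by blast
  qed
qed

text \<open>The higher derivatives of an affine inner map vanish, so the chain rule reduces to mapping all
  directions by its linear part.\<close>

lemma cinfinity_on_affine_substitution:
  assumes J: "bounded_linear J" and f: "cinfinity_on U f" and U': "\<And>x. x \<in> U' \<Longrightarrow> c + J x \<in> U"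
  shows "cinfinity_on U' (\<lambda>x. f (c + J x))"
proof -
  interpret J: bounded_linear J by (rule J)
  obtain L where L: "L > 0" "\<And>y. norm (J y) \<le> norm y * L" using J.pos_bounded by blast
  obtain D where f: "\<And>x. x \<in> U \<Longrightarrow> D x [] = f x" "\<And>x k. x \<in> U \<Longrightarrow> bounded_multilinear k (D x)"
    "\<And>x k e. x \<in> U \<Longrightarrow> e > 0 \<Longrightarrow> \<exists>d>0. \<forall>h. norm h < d \<and> x + h \<in> U \<longrightarrow> (\<forall>vs. length vs = k \<longrightarrow>
        norm (D (x + h) vs - D x vs - D x (h # vs)) \<le> e * norm h * (\<Prod>v\<leftarrow>vs. norm v))"
    using f unfolding cinfinity_on_def by blast
  have prod: "(\<Prod>v\<leftarrow>map J vs. norm v) \<le> L ^ length vs * (\<Prod>v\<leftarrow>vs. norm v)" for vs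
  proof (induction vs)
    case (Cons v vs)
    have "norm (J v) * (\<Prod>v\<leftarrow>map J vs. norm v)
        \<le> (norm v * L) * (L ^ length vs * (\<Prod>v\<leftarrow>vs. norm v))"
      using L by (intro mult_mono L Cons prod_list_norm_nonneg) auto
    then show ?case by (simp add: mult_ac)
  qed simp
  show ?thesis
    unfolding cinfinity_on_def
  proof (intro exI[of _ "\<lambda>x vs. D (c + J x) (map J vs)"] ballI conjI allI impI)
    fix x assume "x \<in> U'"
    then have x: "c + J x \<in> U" by (rule U')
    show "D (c + J x) (map J []) = f (c + J x)" using f x by simp
    show "bounded_multilinear k (\<lambda>vs. D (c + J x) (map J vs))" for k
    proof -
      have lin: "linear (\<lambda>h. D (c + J x) ((map J vs)[i := h]))" if "length vs = k \<and> i < k" for vs i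
        using f(2)[OF x, of k] that unfolding bounded_multilinear_def by simp
      obtain K where K: "\<And>vs. length vs = k \<Longrightarrow> norm (D (c + J x) vs) \<le> K * (\<Prod>v\<leftarrow>vs. norm v)"
        using f(2)[OF x, of k] unfolding bounded_multilinear_def by blast
      have "norm (D (c + J x) (map J vs)) \<le> (\<bar>K\<bar> * L ^ k) * (\<Prod>v\<leftarrow>vs. norm v)" if "length vs = k" for vs
      proof -
        have "norm (D (c + J x) (map J vs)) \<le> K * (\<Prod>v\<leftarrow>map J vs. norm v)"
          using K[of "map J vs"] that by simp
        also have "\<dots> \<le> \<bar>K\<bar> * (\<Prod>v\<leftarrow>map J vs. norm v)"
          by (intro mult_right_mono prod_list_norm_nonneg) auto
        also have "\<dots> \<le> \<bar>K\<bar> * (L ^ k * (\<Prod>v\<leftarrow>vs. norm v))"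
          using prod[of vs] that by (intro mult_left_mono) auto
        finally show ?thesis by (simp add: mult.assoc)
      qed
      then show ?thesis
        using linear_compose[OF J.linear lin] unfolding bounded_multilinear_def comp_def map_update
        by blast
    qed
    fix k and e :: real assume e: "e > 0"
    then have e': "e / L ^ Suc k > 0" using L by simp
    from f(3)[OF x this, of k] obtain d where d: "d > 0"
      "\<And>h vs. norm h < d \<Longrightarrow> c + J x + h \<in> U \<Longrightarrow> length vs = k \<Longrightarrow>
        norm (D (c + J x + h) vs - D (c + J x) vs - D (c + J x) (h # vs))
          \<le> e / L ^ Suc k * norm h * (\<Prod>v\<leftarrow>vs. norm v)"
      by blast
    have "norm (D (c + J (x + h)) (map J vs) - D (c + J x) (map J vs) - D (c + J x) (map J (h # vs)))
        \<le> e * norm h * (\<Prod>v\<leftarrow>vs. norm v)"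
      if h: "norm h < d / L" "x + h \<in> U'" and k: "length vs = k" for h vs
    proof -
      have eq: "c + J (x + h) = c + J x + J h" by (simp add: J.add)
      have "norm (J h) < d" using L(2)[of h] h(1) L(1) by (simp add: pos_less_divide_eq)
      then have "norm (D (c + J x + J h) (map J vs) - D (c + J x) (map J vs) - D (c + J x) (J h # map J vs))
          \<le> e / L ^ Suc k * norm (J h) * (\<Prod>v\<leftarrow>map J vs. norm v)"
        using U'[OF h(2)] k unfolding eq by (intro d(2)) auto
      also have "\<dots> \<le> e / L ^ Suc k * (norm h * L) * (L ^ k * (\<Prod>v\<leftarrow>vs. norm v))"
        using e' prod[of vs] k L
        by (intro mult_mono L prod_list_norm_nonneg mult_nonneg_nonneg) auto
      also have "\<dots> = e * norm h * (\<Prod>v\<leftarrow>vs. norm v)" using L(1) by simp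
      finally show ?thesis unfolding eq by simp
    qed
    moreover have "d / L > 0" using d(1) L(1) by simp
    ultimately show "\<exists>d>0. \<forall>h. norm h < d \<and> x + h \<in> U' \<longrightarrow> (\<forall>vs. length vs = k \<longrightarrow>
        norm (D (c + J (x + h)) (map J vs) - D (c + J x) (map J vs) - D (c + J x) (map J (h # vs)))
          \<le> e * norm h * (\<Prod>v\<leftarrow>vs. norm v))"
      by blast
  qed
qed

section \<open>Dimensions, and invariance under equivalence of operators\<close>

lemma edim_image_le:
  assumes "linear f"
  shows "edim (f ` V) \<le> edim V"
proof (cases "\<exists>B. finite B \<and> V \<subseteq> span B")
  case True
  then obtain B0 where B0: "finite B0" "V \<subseteq> span B0" by blast
  obtain B where B: "B \<subseteq> V" "independent B" "V \<subseteq> span B" "card B = dim V"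
    using basis_exists by blast
  have fin: "finite B"
    using independent_span_bound[OF B0(1) B(2)] B(1) B0(2) by blast
  have "f ` V \<subseteq> f ` span B" using B(3) by blast
  also have "\<dots> = span (f ` B)" using assms by (simp add: linear_span_image)
  finally have sp: "f ` V \<subseteq> span (f ` B)" .
  then have "dim (f ` V) \<le> card (f ` B)" using fin by (simp add: dim_le_card)
  also have "\<dots> \<le> dim V" using fin B(4) card_image_le by metis
  finally show ?thesis using True sp fin by (auto simp: edim_def)
next
  case False
  then have "edim V = \<infinity>" unfolding edim_def by (rule if_not_P)
  then show ?thesis by simp
qed

lemma edim_image_eq:
  assumes "linear f" "linear g" "\<And>x. x \<in> V \<Longrightarrow> g (f x) = x"
  shows "edim (f ` V) = edim V"
proof (rule antisym)
  have "g ` f ` V = V" using assms(3) by force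
  then show "edim V \<le> edim (f ` V)" using edim_image_le[OF assms(2), of "f ` V"] by simp
qed (rule edim_image_le[OF assms(1)])

text \<open>This is where finiteness of the prescribed dimension enters.\<close>

lemma subspace_eq_if_edim_le:
  assumes "subspace V" "V \<subseteq> W" "edim W \<le> edim V" "edim V = enat k"
  shows "V = W"
proof (rule ccontr)
  assume "V \<noteq> W"
  then obtain w where w: "w \<in> W" "w \<notin> V" using assms(2) by blast
  have "\<exists>B. finite B \<and> W \<subseteq> span B"
  proof (rule ccontr)
    assume "\<not> ?thesis"
    then have "edim W = \<infinity>" unfolding edim_def by (rule if_not_P)
    then show False using assms(3,4) by simp
  qed
  then obtain B0 where B0: "finite B0" "W \<subseteq> span B0" by blast
  obtain C where C: "C \<subseteq> W" "independent C" "W \<subseteq> span C" "card C = dim W"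
    using basis_exists by blast
  have finC: "finite C" using independent_span_bound[OF B0(1) C(2)] C(1) B0(2) by blast
  obtain B where B: "B \<subseteq> V" "independent B" "V \<subseteq> span B" "card B = dim V"
    using basis_exists by blast
  have finB: "finite B" using independent_span_bound[OF B0(1) B(2)] B(1) B0(2) assms(2) by blast
  have "w \<notin> span B" using w B assms(1) span_minimal by blast
  then have ind: "independent (insert w B)" "w \<notin> B"
    using B(2) by (auto simp: independent_insert span_base)
  have "card (insert w B) \<le> card C"
    using independent_span_bound[OF finC ind(1)] w B(1) C(3) assms(2) by blast
  then have "dim V < dim W" using ind finB B C by simp
  moreover have "edim W = enat (dim W)"
    unfolding edim_def using B0 by (intro if_P) blast
  moreover have "edim V = enat (dim V)"
    unfolding edim_def using B0 assms(2) by (intro if_P) blast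
  ultimately show False using assms(3) by simp
qed

lemma linear_blinfun_apply: "linear (blinfun_apply T)"
  by (rule bounded_linear.linear[OF blinfun.bounded_linear_right])

lemma subspace_null_space: "subspace (null_space T)"
  by (auto simp: null_space_def subspace_def blinfun.bilinear_simps)

lemma subspace_range: "subspace (range (blinfun_apply T))"
  by (rule linear_subspace_image[OF linear_blinfun_apply subspace_UNIV])

lemma invertible_images:
  assumes C: "is_inverse C Ci" and G: "is_inverse G Gi"
  shows "range (C o\<^sub>L T o\<^sub>L G) = blinfun_apply C ` range T"
    and "null_space (C o\<^sub>L T o\<^sub>L G) = blinfun_apply Gi ` null_space T"
proof -
  note [simp] = is_inverseD[OF C] is_inverseD[OF G]
  have "C (T x) = (C o\<^sub>L T o\<^sub>L G) (Gi x)" for x by simp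
  then have "C (T x) \<in> range (C o\<^sub>L T o\<^sub>L G)" for x by (metis rangeI)
  then show "range (C o\<^sub>L T o\<^sub>L G) = blinfun_apply C ` range T" by auto
  have "C y = 0 \<longleftrightarrow> y = 0" for y by (metis is_inverseD(2)[OF C] blinfun.zero_right)
  moreover have "x = Gi (G x)" for x by simp
  ultimately show "null_space (C o\<^sub>L T o\<^sub>L G) = blinfun_apply Gi ` null_space T"
    by (force simp: null_space_def)
qed

lemma closed_image_invertible:
  assumes "is_inverse a w" "closed V"
  shows "closed (blinfun_apply a ` V)"
proof -
  have "blinfun_apply a ` V = blinfun_apply w -` V"
  proof (intro equalityI subsetI)
    fix y assume "y \<in> blinfun_apply w -` V"
    then show "y \<in> blinfun_apply a ` V" by (metis is_inverseD(1)[OF assms(1)] imageI vimageD)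
  qed (auto simp: is_inverseD[OF assms(1)])
  then show ?thesis using assms(2) by (simp add: closed_vimage blinfun.continuous_on)
qed

lemma complementary_image_invertible:
  assumes a: "is_inverse a w" and VW: "complementary V W"
  shows "complementary (blinfun_apply a ` V) (blinfun_apply a ` W)"
proof -
  have lin: "linear (blinfun_apply a)"
    by (rule bounded_linear.linear[OF blinfun.bounded_linear_right])
  have inj: "inj (blinfun_apply a)" by (metis injI is_inverseD(2)[OF a])
  have int: "V \<inter> W = {0}" and sum: "\<And>x. \<exists>v\<in>V. \<exists>u\<in>W. x = v + u"
    using VW unfolding complementary_def by blast+
  have "y \<in> {v + u |v u. v \<in> blinfun_apply a ` V \<and> u \<in> blinfun_apply a ` W}" for y
  proof -
    obtain v u where vu: "v \<in> V" "u \<in> W" "w y = v + u" using sum by blast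
    then have "y = a v + a u" by (metis blinfun.add_right is_inverseD(1)[OF a])
    then show ?thesis using vu by blast
  qed
  moreover have "blinfun_apply a ` V \<inter> blinfun_apply a ` W = {0}"
    unfolding image_Int[OF inj, symmetric] int by simp
  moreover have "subspace (blinfun_apply a ` V)" "subspace (blinfun_apply a ` W)"
    using VW by (auto simp: complementary_def intro: linear_subspace_image[OF lin])
  ultimately show ?thesis unfolding complementary_def by blast
qed

lemma edim_image_invertible:
  assumes "is_inverse a w"
  shows "edim (blinfun_apply a ` V) = edim V"
  by (rule edim_image_eq[where g = "blinfun_apply w"])
    (simp_all add: bounded_linear.linear[OF blinfun.bounded_linear_right] is_inverseD[OF assms])

lemma is_inverse_sym: "is_inverse a w \<Longrightarrow> is_inverse w a"
  by (simp add: is_inverse_def)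

lemma equivalence_invariants:
  assumes T: "T \<in> double_split" and C: "C \<in> invertibles" and G: "G \<in> invertibles"
  shows "C o\<^sub>L T o\<^sub>L G \<in> double_split"
    and "edim (null_space (C o\<^sub>L T o\<^sub>L G)) = edim (null_space T)"
    and "edim (range (C o\<^sub>L T o\<^sub>L G)) = edim (range T)"
    and "ecodim (range (C o\<^sub>L T o\<^sub>L G)) = ecodim (range T)"
proof -
  obtain Ci Gi where Ci: "is_inverse C Ci" and "is_inverse G Gi"
    using C G by (auto simp: invertibles_def)
  then have Gi: "is_inverse Gi G" by (simp add: is_inverse_sym)
  note img = invertible_images[OF Ci \<open>is_inverse G Gi\<close>, of T]
  obtain R N where R: "closed R" "complementary (null_space T) R"
    and N: "closed N" "complementary (range T) N" and "closed (range T)"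
    using T unfolding double_split_def by blast
  have cN: "complementary (blinfun_apply C ` range T) (blinfun_apply C ` N)"
    by (rule complementary_image_invertible[OF Ci N(2)])
  show "C o\<^sub>L T o\<^sub>L G \<in> double_split"
    unfolding double_split_def mem_Collect_eq img
    using cN closed_image_invertible[OF Ci \<open>closed (range T)\<close>] closed_image_invertible[OF Ci N(1)]
      closed_image_invertible[OF Gi R(1)] complementary_image_invertible[OF Gi R(2)] by blast
  show "edim (null_space (C o\<^sub>L T o\<^sub>L G)) = edim (null_space T)"
    unfolding img by (rule edim_image_invertible[OF Gi])
  show "edim (range (C o\<^sub>L T o\<^sub>L G)) = edim (range T)"
    unfolding img by (rule edim_image_invertible[OF Ci])
  show "ecodim (range (C o\<^sub>L T o\<^sub>L G)) = ecodim (range T)"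
    unfolding img ecodim_eq[OF cN] ecodim_eq[OF N(2)] by (rule edim_image_invertible[OF Ci])
qed

section \<open>The Schur complement relative to a generalized inverse\<close>

definition inl_blinfun :: "'a::real_normed_vector \<Rightarrow>\<^sub>L ('a \<times> 'b::real_normed_vector)"
  where "inl_blinfun = Blinfun (\<lambda>x. (x, 0))"

definition inr_blinfun :: "'b::real_normed_vector \<Rightarrow>\<^sub>L ('a::real_normed_vector \<times> 'b)"
  where "inr_blinfun = Blinfun (\<lambda>y. (0, y))"

lemma inl_blinfun_apply [simp]: "blinfun_apply inl_blinfun x = (x, 0)"
  unfolding inl_blinfun_def
  by (subst bounded_linear_Blinfun_apply) (auto intro!: bounded_linear_Pair bounded_linear_ident bounded_linear_zero)

lemma inr_blinfun_apply [simp]: "blinfun_apply inr_blinfun y = (0, y)"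
  unfolding inr_blinfun_def
  by (subst bounded_linear_Blinfun_apply) (auto intro!: bounded_linear_Pair bounded_linear_ident bounded_linear_zero)

locale generalized_inverse =
  fixes A :: "'e::banach \<Rightarrow>\<^sub>L 'f::banach" and B :: "'f \<Rightarrow>\<^sub>L 'e"
  assumes ABA [simp]: "blinfun_apply A (blinfun_apply B (blinfun_apply A x)) = blinfun_apply A x"
    and BAB [simp]: "blinfun_apply B (blinfun_apply A (blinfun_apply B y)) = blinfun_apply B y"
begin

definition coker_proj :: "'f \<Rightarrow>\<^sub>L 'f"
  where "coker_proj = id_blinfun - (A o\<^sub>L B)"

definition ker_proj :: "'e \<Rightarrow>\<^sub>L 'e"
  where "ker_proj = id_blinfun - (B o\<^sub>L A)"

lemma coker_proj_apply: "coker_proj y = y - A (B y)"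
  by (simp add: coker_proj_def blinfun.bilinear_simps)

lemma ker_proj_apply: "ker_proj x = x - B (A x)"
  by (simp add: ker_proj_def blinfun.bilinear_simps)

lemma proj_simps [simp]:
  "A (blinfun_apply ker_proj x) = 0" "B (blinfun_apply coker_proj y) = 0"
  "coker_proj (blinfun_apply A x) = 0" "ker_proj (blinfun_apply B y) = 0"
  "coker_proj (blinfun_apply coker_proj y) = coker_proj y"
  "ker_proj (blinfun_apply ker_proj x) = ker_proj x"
  by (simp_all add: coker_proj_apply ker_proj_apply blinfun.bilinear_simps)

lemma tangent_ops_eq: "tangent_ops A = {T. coker_proj o\<^sub>L T o\<^sub>L ker_proj = 0}"
proof -
  have "blinfun_apply T ` null_space A \<subseteq> range A \<longleftrightarrow> coker_proj o\<^sub>L T o\<^sub>L ker_proj = 0" for T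
  proof
    assume T: "blinfun_apply T ` null_space A \<subseteq> range A"
    have "ker_proj x \<in> null_space A" for x by (simp add: null_space_def)
    then have "T (ker_proj x) \<in> range A" for x using T by blast
    then have "coker_proj (T (ker_proj x)) = 0" for x by (metis imageE proj_simps(3))
    then show "coker_proj o\<^sub>L T o\<^sub>L ker_proj = 0" by (intro blinfun_eqI) simp
  next
    assume T: "coker_proj o\<^sub>L T o\<^sub>L ker_proj = 0"
    have "T x = A (B (T x))" if "A x = 0" for x
      using arg_cong[OF T, of "\<lambda>f. blinfun_apply f x"] that
      by (simp add: ker_proj_apply coker_proj_apply)
    then show "blinfun_apply T ` null_space A \<subseteq> range A" by (force simp: null_space_def)
  qed
  then show ?thesis by (simp add: tangent_ops_def)
qed

lemma tangent_ops_complemented: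
  "closed (tangent_ops A) \<and> (\<exists>N. closed N \<and> complementary (tangent_ops A) N)"
proof -
  let ?N = "{T. coker_proj o\<^sub>L T o\<^sub>L ker_proj = T}"
  let ?p = "\<lambda>T. coker_proj o\<^sub>L T o\<^sub>L ker_proj"
  have bl: "bounded_linear ?p" by (intro bounded_linear_intros)
  interpret p: bounded_linear ?p by (rule bl)
  have cont: "continuous_on UNIV ?p" by (rule bounded_linear.continuous_on[OF bl continuous_on_id])
  have idem: "?p (?p T) = ?p T" for T by (rule blinfun_eqI) simp
  have "closed (tangent_ops A)"
    unfolding tangent_ops_eq by (intro closed_Collect_eq cont continuous_on_const)
  moreover have "closed ?N" by (intro closed_Collect_eq cont continuous_on_id)
  moreover have "complementary (tangent_ops A) ?N"
    unfolding complementary_def tangent_ops_eq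
  proof (intro conjI)
    show "subspace {T. ?p T = 0}" "subspace ?N"
      by (auto simp: subspace_def p.add p.scaleR p.zero simp del: blinfun_compose_zero)
    show "{T. ?p T = 0} \<inter> ?N = {0}" using p.zero by auto
    have "T \<in> {v + w |v w. v \<in> {T. ?p T = 0} \<and> w \<in> ?N}" for T
    proof -
      have "T = (T - ?p T) + ?p T" "?p (T - ?p T) = 0" by (simp_all add: p.diff idem)
      then show ?thesis using idem by blast
    qed
    then show "{v + w |v w. v \<in> {T. ?p T = 0} \<and> w \<in> ?N} = UNIV" by blast
  qed
  ultimately show ?thesis by blast
qed

definition pencil_linear :: "('e \<Rightarrow>\<^sub>L 'f) \<Rightarrow> (('e \<times> 'f) \<Rightarrow>\<^sub>L ('e \<times> 'f))" where
  "pencil_linear T =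
     inr_blinfun o\<^sub>L ((A o\<^sub>L B o\<^sub>L T o\<^sub>L ker_proj o\<^sub>L fst_blinfun) + (T o\<^sub>L B o\<^sub>L snd_blinfun))"

text \<open>In block form on \<open>E \<times> F\<close>, the pencil is the identity at \<open>E\<close>, has \<open>I + (T - A) B\<close> at \<open>F\<close>, and
  \<open>AB T (I - BA)\<close> (the block \<open>T12\<close>) as its entry from \<open>E\<close> to \<open>F\<close>. Up to composition with \<open>B\<close>,
  the operator \<open>I + (T - A) B\<close> restricts to the column of \<open>T11\<close> and \<open>T21\<close> on the range of \<open>A\<close>, and
  it is the identity on the complement. Inverting this triangular matrix multiplies the three blocks together, so that a corner of
  the inverse is \<open>T21 T11^-1 T12\<close>.\<close>

definition pencil :: "('e \<Rightarrow>\<^sub>L 'f) \<Rightarrow> (('e \<times> 'f) \<Rightarrow>\<^sub>L ('e \<times> 'f))" where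
  "pencil T = (id_blinfun - (inr_blinfun o\<^sub>L A o\<^sub>L B o\<^sub>L snd_blinfun)) + pencil_linear T"

text \<open>This is the set of all \<open>T\<close> with invertible block \<open>T11\<close>; phrased through the pencil, it is open
  and visibly independent of the block \<open>T22\<close>.\<close>

definition chart_domain :: "('e \<Rightarrow>\<^sub>L 'f) set" where
  "chart_domain = {T. pencil T \<in> invertibles}"

definition corner :: "(('e \<times> 'f) \<Rightarrow>\<^sub>L ('e \<times> 'f)) \<Rightarrow> ('e \<Rightarrow>\<^sub>L 'f)" where
  "corner w = coker_proj o\<^sub>L snd_blinfun o\<^sub>L w o\<^sub>L inl_blinfun o\<^sub>L ker_proj"

definition correction :: "('e \<Rightarrow>\<^sub>L 'f) \<Rightarrow> ('e \<Rightarrow>\<^sub>L 'f)" where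
  "correction T = corner (op_inverse (pencil T))"

lemma pencil_apply: "pencil T z = (fst z, snd z + A (B (T (ker_proj (fst z)))) + (T - A) (B (snd z)))"
  by (cases z) (simp add: pencil_def pencil_linear_def blinfun.bilinear_simps)

lemma bounded_linear_pencil_linear: "bounded_linear pencil_linear"
  unfolding pencil_linear_def by (intro bounded_linear_intros)

lemma bounded_linear_corner: "bounded_linear corner"
  unfolding corner_def by (intro bounded_linear_intros)

lemma correction_simps [simp]:
  "B (blinfun_apply (correction T) x) = 0"
  "correction T (blinfun_apply B y) = 0"
  "correction T (blinfun_apply ker_proj x) = correction T x"
  "coker_proj (blinfun_apply (correction T) x) = correction T x"
  by (simp_all add: correction_def corner_def)

text \<open>The two conditions say that \<open>V\<close> sits in block 22, which the pencil does not contain.\<close>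

lemma pencil_add:
  assumes "\<And>x. B (blinfun_apply V x) = 0" "\<And>y. V (blinfun_apply B y) = 0"
  shows "pencil (T + V) = pencil T"
  by (rule blinfun_eqI) (simp add: pencil_apply blinfun.bilinear_simps assms)

text \<open>Consequently adding or subtracting the correction changes neither membership in the chart domain
  nor the correction itself, which makes the two operations inverse to each other.\<close>

lemma correction_invariant:
  "pencil (T + correction T) = pencil T" "pencil (T - correction T) = pencil T"
proof -
  show "pencil (T + correction T) = pencil T" by (rule pencil_add) simp_all
  have "pencil (T + - correction T) = pencil T" by (rule pencil_add) (simp_all add: blinfun.minus_left blinfun.minus_right)
  then show "pencil (T - correction T) = pencil T" by simp
qed

lemma pencil_centre: "pencil A = id_blinfun"
proof (rule blinfun_eqI)
  fix z :: "'e \<times> 'f"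
  show "pencil A z = id_blinfun z" unfolding pencil_apply by simp
qed

lemma centre_in_chart_domain: "A \<in> chart_domain"
proof -
  have "is_inverse (pencil A) id_blinfun" unfolding pencil_centre by (rule is_inverseI) simp_all
  then show ?thesis by (auto simp: chart_domain_def invertibles_def)
qed

lemma open_chart_domain: "open chart_domain"
proof -
  have "continuous_on UNIV pencil" unfolding pencil_def
    by (intro continuous_intros bounded_linear.continuous_on[OF bounded_linear_pencil_linear])
  then show ?thesis
    using open_vimage[OF open_invertibles] by (simp add: chart_domain_def vimage_def)
qed

definition schur :: "('e \<Rightarrow>\<^sub>L 'f) \<Rightarrow> ('e \<Rightarrow>\<^sub>L 'f)" where
  "schur T = (coker_proj o\<^sub>L T o\<^sub>L ker_proj) - correction T"

lemma schur_apply: "schur T x = coker_proj (T (ker_proj x)) - correction T x"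
  by (simp add: schur_def blinfun.bilinear_simps)

lemma schur_simps [simp]:
  "B (blinfun_apply (schur T) x) = 0" "schur T (blinfun_apply B y) = 0"
  by (simp_all add: schur_apply blinfun.bilinear_simps)

text \<open>Block elimination: with \<open>C = I + (T - A) B\<close> one has \<open>C A = T B A\<close>, so \<open>C^-1 T\<close> agrees with \<open>A\<close>
  on the range of \<open>B\<close>. On the kernel of \<open>A\<close> it is \<open>z = C^-1 T x\<close>, whose component outside the range
  of \<open>A\<close> is the Schur complement, while the component \<open>A B z\<close> is removed by the unipotent factor
  \<open>G = I + B C^-1 T (I - BA)\<close>.\<close>

lemma schur_factorization:
  assumes "T \<in> chart_domain"
  obtains C G where "C \<in> invertibles" "G \<in> invertibles" "T = C o\<^sub>L (A + schur T) o\<^sub>L G"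
proof -
  define w where "w = op_inverse (pencil T)"
  have w: "is_inverse (pencil T) w"
    using assms is_inverse_op_inverse unfolding w_def chart_domain_def by blast
  define C where "C = id_blinfun + ((T - A) o\<^sub>L B)"
  \<comment> \<open>\<open>H\<close> is the inverse of \<open>C\<close>, read off from the inverse of the triangular pencil.\<close>
  define H where "H = snd_blinfun o\<^sub>L w o\<^sub>L inr_blinfun"
  have Cx: "C y = y + (T - A) (B y)" for y by (simp add: C_def blinfun.bilinear_simps)
  have wpair: "fst (w (e, y)) = e" "C (snd (w (e, y))) = y - A (B (T (ker_proj e)))" for e y
  proof -
    have "fst (pencil T (w (e, y))) = e" "snd (pencil T (w (e, y))) = y"
      by (simp_all only: is_inverseD(1)[OF w] fst_conv snd_conv)
    then have *: "fst (w (e, y)) = e"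
      "snd (w (e, y)) + A (B (T (ker_proj (fst (w (e, y)))))) + (T - A) (B (snd (w (e, y)))) = y"
      unfolding pencil_apply fst_conv snd_conv .
    show "fst (w (e, y)) = e" by (rule *(1))
    show "C (snd (w (e, y))) = y - A (B (T (ker_proj e)))"
      using *(2) unfolding *(1) by (simp add: Cx algebra_simps)
  qed
  have CH: "is_inverse C H"
  proof (rule is_inverseI)
    show "C (H y) = y" for y by (simp add: H_def wpair)
    have "w (0, C y) = (0, y)" for y
      using is_inverseD(2)[OF w, of "(0, y)"] by (simp add: pencil_apply Cx)
    then show "H (C y) = y" for y by (simp add: H_def)
  qed
  have corr: "correction T x = - coker_proj (H (A (B (T (ker_proj x)))))" for x
  proof -
    have "snd (w (ker_proj x, 0)) = H (- A (B (T (ker_proj x))))"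
      using is_inverseD(2)[OF CH, of "snd (w (ker_proj x, 0))"] by (simp add: wpair)
    then show ?thesis by (simp add: correction_def corner_def w_def[symmetric] blinfun.minus_right)
  qed
  have Hc: "H (coker_proj y) = coker_proj y" for y
    using is_inverseD(2)[OF CH, of "coker_proj y"] by (simp add: Cx)
  define X where "X = B o\<^sub>L H o\<^sub>L T o\<^sub>L ker_proj"
  define G where "G = id_blinfun + X"
  \<comment> \<open>\<open>X\<close> maps into the range of \<open>B\<close>, on which it vanishes; so its square is zero.\<close>
  have "is_inverse G (id_blinfun - X)"
    by (rule is_inverseI) (simp_all add: G_def X_def blinfun.bilinear_simps)
  then have G: "G \<in> invertibles" by (auto simp: invertibles_def)
  have "T x = C ((A + schur T) (G x))" for x
  proof -
    define z where "z = H (T (ker_proj x))"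
    have schur_z: "schur T x = coker_proj z"
    proof -
      have "T (ker_proj x) = A (B (T (ker_proj x))) + coker_proj (T (ker_proj x))"
        by (simp add: coker_proj_apply)
      then have "z = H (A (B (T (ker_proj x)))) + coker_proj (T (ker_proj x))"
        unfolding z_def by (metis Hc blinfun.add_right)
      then show ?thesis by (simp add: schur_apply corr blinfun.bilinear_simps)
    qed
    have "(A + schur T) (G x) = A x + A (B z) + schur T x"
      by (simp add: G_def X_def z_def blinfun.bilinear_simps)
    also have "\<dots> = A x + z" by (simp add: schur_z coker_proj_apply)
    also have "C \<dots> = T (B (A x)) + T (ker_proj x)"
    proof -
      have "C (A x) = T (B (A x))" by (simp add: Cx blinfun.bilinear_simps)
      moreover have "C z = T (ker_proj x)" unfolding z_def by (rule is_inverseD(1)[OF CH])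
      ultimately show ?thesis by (simp add: blinfun.add_right)
    qed
    also have "\<dots> = T x" by (simp add: ker_proj_apply blinfun.bilinear_simps)
    finally show ?thesis by simp
  qed
  then have "T = C o\<^sub>L (A + schur T) o\<^sub>L G" by (intro blinfun_eqI) simp
  moreover have "C \<in> invertibles" using CH by (auto simp: invertibles_def)
  ultimately show thesis using G that by blast
qed

text \<open>At \<open>A\<close> the blocks 12 and 21 vanish, so their product vanishes to second order. In terms of the
  pencil: it is the identity there, and its linear part has no entry from \<open>E\<close> to the complement of
  the range of \<open>A\<close>.\<close>

lemma correction_has_derivative: "(correction has_derivative (\<lambda>h. 0)) (at A)"
proof -
  have "is_inverse (pencil A) id_blinfun" unfolding pencil_centre by (rule is_inverseI) simp_all
  then have 1: "(op_inverse has_derivative (\<lambda>h. - (id_blinfun o\<^sub>L h o\<^sub>L id_blinfun))) (at (pencil A))"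
    by (rule op_inverse_has_derivative)
  have 2: "(pencil has_derivative pencil_linear) (at A)"
    unfolding pencil_def
    by (rule has_derivative_eq_rhs[OF has_derivative_add[OF has_derivative_const
      bounded_linear.has_derivative[OF bounded_linear_pencil_linear has_derivative_ident]]]) simp
  have "(correction has_derivative
      (\<lambda>h. corner (- (id_blinfun o\<^sub>L pencil_linear h o\<^sub>L id_blinfun)))) (at A)"
    unfolding correction_def
    by (rule bounded_linear.has_derivative[OF bounded_linear_corner has_derivative_compose[OF 2 1]])
  moreover have "corner (- (id_blinfun o\<^sub>L pencil_linear h o\<^sub>L id_blinfun)) = 0" for h
    by (rule blinfun_eqI) (simp add: corner_def pencil_linear_def blinfun.bilinear_simps)
  ultimately show ?thesis by simp
qed

lemma cinfinity_on_correction: "cinfinity_on chart_domain correction"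
  unfolding correction_def
  by (rule cinfinity_on_bounded_linear_image[OF bounded_linear_corner], unfold pencil_def,
      rule cinfinity_on_affine_substitution[OF bounded_linear_pencil_linear cinfinity_on_op_inverse])
    (simp add: chart_domain_def pencil_def)

end

section \<open>Classes that are rigid under perturbation by a Schur complement\<close>

context generalized_inverse begin

text \<open>Since \<open>VB = 0\<close>, the operators \<open>A + V\<close> and \<open>A\<close> agree on the range of \<open>B\<close>, which gives the whole
  range of \<open>A\<close>; since \<open>BV = 0\<close>, the kernel of \<open>A + V\<close> lies in that of \<open>B A\<close>, which is the kernel of
  \<open>A\<close>.\<close>

lemma perturbation_subspaces:
  assumes BV: "\<And>x. B (blinfun_apply V x) = 0" and VB: "\<And>y. V (blinfun_apply B y) = 0"
  shows "range A \<subseteq> range (A + V)" "null_space (A + V) \<subseteq> null_space A"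
    "range A = range (A + V) \<Longrightarrow> V = 0" "null_space (A + V) = null_space A \<Longrightarrow> V = 0"
proof -
  have "A x = (A + V) (B (A x))" for x by (simp add: blinfun.add_left VB)
  then show "range A \<subseteq> range (A + V)" by (metis image_subsetI rangeI)
  show "null_space (A + V) \<subseteq> null_space A"
  proof
    fix x assume "x \<in> null_space (A + V)"
    then have "A x + V x = 0" by (simp add: null_space_def blinfun.add_left)
    then have "B (A x + V x) = 0" by simp
    then have "B (A x) = 0" by (simp add: blinfun.add_right BV)
    then have "A x = 0" by (metis ABA blinfun.zero_right)
    then show "x \<in> null_space A" by (simp add: null_space_def)
  qed
  show "V = 0" if "range A = range (A + V)"
  proof (rule blinfun_eqI)
    fix x
    have "(A + V) x \<in> range A" using that by blast
    then obtain u where "A x + V x = A u" by (auto simp: blinfun.add_left)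
    then have u: "V x = A (u - x)" by (simp add: blinfun.diff_right eq_diff_eq add.commute)
    then have "B (A (u - x)) = 0" using BV[of x] by simp
    then have "A (u - x) = 0" by (metis ABA blinfun.zero_right)
    then show "V x = blinfun_apply 0 x" by (simp add: u)
  qed
  show "V = 0" if "null_space (A + V) = null_space A"
  proof (rule blinfun_eqI)
    fix x
    have "ker_proj x \<in> null_space (A + V)" unfolding that by (simp add: null_space_def)
    then have "V (ker_proj x) = 0" by (simp add: null_space_def blinfun.add_left)
    then show "V x = blinfun_apply 0 x" by (simp add: ker_proj_apply blinfun.diff_right VB)
  qed
qed

lemma complementary_coker: "complementary (range A) (range coker_proj)"
proof -
  have "y \<in> {v + w |v w. v \<in> range A \<and> w \<in> range coker_proj}" for y
  proof -
    have "y = A (B y) + coker_proj y" by (simp add: coker_proj_apply)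
    then show ?thesis by blast
  qed
  moreover have "range A \<inter> range coker_proj = {0}"
  proof
    show "range A \<inter> range coker_proj \<subseteq> {0}"
    proof
      fix y assume "y \<in> range A \<inter> range coker_proj"
      then obtain u v where "y = A u" "y = coker_proj v" by blast
      then have "y = coker_proj (A u)" by (metis proj_simps(5))
      then show "y \<in> {0}" by simp
    qed
    show "{0} \<subseteq> range A \<inter> range coker_proj"
      by (metis Int_iff blinfun.zero_right rangeI singletonD subsetI)
  qed
  ultimately show ?thesis
    unfolding complementary_def by (intro conjI subspace_range) auto
qed

text \<open>The projection \<open>I - AB\<close> embeds a complement \<open>N\<close> of the larger range \<open>R(A + V)\<close> into the complement
  \<open>R(I - AB)\<close> of \<open>R(A)\<close>. As both have the same finite dimension, the embedding is onto; so \<open>V x\<close> is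
  the image of some \<open>y \<in> N\<close>. Then \<open>y\<close> lies in \<open>R(A + V)\<close> too, whence \<open>y = 0\<close>.\<close>

lemma perturbation_codim:
  assumes BV: "\<And>x. B (blinfun_apply V x) = 0" and VB: "\<And>y. V (blinfun_apply B y) = 0"
    and split: "A + V \<in> double_split"
    and codim: "ecodim (range A) = enat n" "ecodim (range (A + V)) = enat n"
  shows "V = 0"
proof -
  obtain N where N: "complementary (range (A + V)) N"
    using split unfolding double_split_def by blast
  have sN: "subspace N" and int: "range (A + V) \<inter> N = {0}" using N by (auto simp: complementary_def)
  obtain p where p: "linear p" "\<And>x. p x \<in> N" "\<And>x. x - p x \<in> range (A + V)"
    "\<And>x w. w \<in> N \<Longrightarrow> x - w \<in> range (A + V) \<Longrightarrow> w = p x"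
    using complementary_projection[OF N] by blast
  \<comment> \<open>The projection \<open>p\<close> onto \<open>N\<close> along \<open>R(A + V)\<close> is a left inverse of the embedding.\<close>
  have "p (coker_proj y) = y" if "y \<in> N" for y
  proof (rule p(4)[OF that, symmetric])
    have "coker_proj y - y = A (- B y)" by (simp add: coker_proj_apply blinfun.minus_right)
    then show "coker_proj y - y \<in> range (A + V)"
      using perturbation_subspaces(1)[OF BV VB] by (metis rangeI subsetD)
  qed
  then have "edim (blinfun_apply coker_proj ` N) = edim N" by (rule edim_image_eq[OF linear_blinfun_apply p(1)])
  also have "\<dots> = enat n" using ecodim_eq[OF N] codim by simp
  finally have dim: "edim (blinfun_apply coker_proj ` N) = enat n" .
  have "edim (range coker_proj) = enat n" using ecodim_eq[OF complementary_coker] codim by simp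
  then have onto: "blinfun_apply coker_proj ` N = range coker_proj"
    using dim by (intro subspace_eq_if_edim_le[where k = n] linear_subspace_image[OF linear_blinfun_apply sN]) auto
  show ?thesis
  proof (rule blinfun_eqI)
    fix x
    have "V x = coker_proj (V x)" by (simp add: coker_proj_apply BV)
    then have "V x \<in> blinfun_apply coker_proj ` N" unfolding onto by (metis rangeI)
    then obtain y where y: "y \<in> N" "V x = coker_proj y" by blast
    have "V (ker_proj x) = V x" by (simp add: ker_proj_apply blinfun.diff_right VB)
    then have "y = (A + V) (ker_proj x + B y)"
      using y(2) by (simp add: blinfun.bilinear_simps VB coker_proj_apply)
    then have "y \<in> range (A + V) \<inter> N" using y(1) by (metis IntI rangeI)
    then show "V x = blinfun_apply 0 x" using int y(2) by simp
  qed
qed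

end

text \<open>The properties of a class that make it a submanifold with the tangent spaces \<open>M(A)\<close>. The last
  clause says that \<open>A\<close> is the only member of the form \<open>A + V\<close> with \<open>V\<close> in block 22, the blocks being
  taken with respect to any generalized inverse \<open>B\<close>.\<close>

definition rigid_class :: "('e::banach \<Rightarrow>\<^sub>L 'f::banach) set \<Rightarrow> bool" where
  "rigid_class S \<longleftrightarrow> S \<subseteq> double_split \<and>
     (\<forall>T\<in>S. \<forall>C\<in>invertibles. \<forall>G\<in>invertibles. C o\<^sub>L T o\<^sub>L G \<in> S) \<and>
     (\<forall>A\<in>S. \<forall>B V. generalized_inverse A B \<longrightarrow> (\<forall>x. B (blinfun_apply V x) = 0) \<longrightarrow>
        (\<forall>y. V (blinfun_apply B y) = 0) \<longrightarrow> A + V \<in> S \<longrightarrow> V = 0)"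

lemma rigid_class_double_split: "rigid_class S \<Longrightarrow> S \<subseteq> double_split"
  by (simp add: rigid_class_def)

lemma rigid_class_equivalence:
  "rigid_class S \<Longrightarrow> T \<in> S \<Longrightarrow> C \<in> invertibles \<Longrightarrow> G \<in> invertibles \<Longrightarrow> C o\<^sub>L T o\<^sub>L G \<in> S"
  by (simp add: rigid_class_def)

lemma rigid_class_perturbation:
  assumes "rigid_class S" "A \<in> S" "A + V \<in> S" "generalized_inverse A B"
    "\<And>x. B (blinfun_apply V x) = 0" "\<And>y. V (blinfun_apply B y) = 0"
  shows "V = 0"
  using assms unfolding rigid_class_def by metis

lemma rigid_class_rank: "rigid_class (rank_class k :: ('e::banach \<Rightarrow>\<^sub>L 'f::banach) set)"
proof -
  have "V = 0"
    if "generalized_inverse A B" and AV: "A \<in> rank_class k" "A + V \<in> rank_class k"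
      and BV: "\<And>x. B (blinfun_apply V x) = 0" "\<And>y. V (blinfun_apply B y) = 0"
    for A V :: "'e \<Rightarrow>\<^sub>L 'f" and B
  proof -
    interpret generalized_inverse A B by fact
    have "range A = range (A + V)"
      using AV perturbation_subspaces(1)[OF BV]
      by (intro subspace_eq_if_edim_le[where k = k] subspace_range) (auto simp: rank_class_def)
    then show ?thesis by (rule perturbation_subspaces(3)[OF BV])
  qed
  then show ?thesis
    unfolding rigid_class_def using equivalence_invariants by (fastforce simp: rank_class_def)
qed

text \<open>A finite kernel dimension excludes that the kernel shrinks, a finite codimension that the range
  grows; one of the two suffices, as either forces \<open>V = 0\<close>.\<close>

lemma rigid_class_Phi:
  assumes "m \<noteq> \<infinity> \<or> n \<noteq> \<infinity>"
  shows "rigid_class (Phi_class m n :: ('e::banach \<Rightarrow>\<^sub>L 'f::banach) set)"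
proof -
  have "V = 0"
    if "generalized_inverse A B" and AV: "A \<in> Phi_class m n" "A + V \<in> Phi_class m n"
      and BV: "\<And>x. B (blinfun_apply V x) = 0" "\<And>y. V (blinfun_apply B y) = 0"
    for A V :: "'e \<Rightarrow>\<^sub>L 'f" and B
  proof -
    interpret generalized_inverse A B by fact
    consider i where "m = enat i" | j where "n = enat j" using assms by auto
    then show ?thesis
    proof cases
      case 1
      then have "null_space (A + V) = null_space A"
        using AV perturbation_subspaces(2)[OF BV]
        by (intro subspace_eq_if_edim_le[where k = i] subspace_null_space) (auto simp: Phi_class_def)
      then show ?thesis by (rule perturbation_subspaces(4)[OF BV])
    next
      case 2
      then show ?thesis using AV by (intro perturbation_codim[OF BV]) (auto simp: Phi_class_def)
    qed
  qed
  then show ?thesis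
    unfolding rigid_class_def using equivalence_invariants by (fastforce simp: Phi_class_def)
qed

text \<open>By the factorization, \<open>T\<close> and \<open>A + schur T\<close> are equivalent, so both or neither belong to the
  class; for the latter this is decided by rigidity.\<close>

lemma (in generalized_inverse) mem_class_iff_schur:
  assumes S: "rigid_class S" "A \<in> S" and T: "T \<in> chart_domain"
  shows "T \<in> S \<longleftrightarrow> schur T = 0"
proof -
  obtain C G where CG: "C \<in> invertibles" "G \<in> invertibles" "T = C o\<^sub>L (A + schur T) o\<^sub>L G"
    by (rule schur_factorization[OF T])
  show ?thesis
  proof
    assume "T \<in> S"
    obtain Ci Gi where i: "is_inverse C Ci" "is_inverse G Gi" using CG by (auto simp: invertibles_def)
    have inv: "Ci \<in> invertibles" "Gi \<in> invertibles"
      using i is_inverse_sym by (auto simp: invertibles_def)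
    have "T (Gi x) = C ((A + schur T) x)" for x
      by (subst CG(3)) (simp add: is_inverseD[OF i(2)])
    then have "Ci o\<^sub>L T o\<^sub>L Gi = A + schur T"
      by (intro blinfun_eqI) (simp add: is_inverseD[OF i(1)])
    then have "A + schur T \<in> S" using rigid_class_equivalence[OF S(1) \<open>T \<in> S\<close> inv] by simp
    then show "schur T = 0"
      by (rule rigid_class_perturbation[OF S]) (fact generalized_inverse_axioms schur_simps)+
  next
    assume "schur T = 0"
    then have "T = C o\<^sub>L A o\<^sub>L G" using CG(3) by simp
    then show "T \<in> S" using rigid_class_equivalence[OF S CG(1,2)] by simp
  qed
qed

section \<open>The chart and the tangent space\<close>

context generalized_inverse begin

text \<open>Since \<open>\<phi>\<close> maps the chart domain onto itself, the image of the class is the trace of \<open>M(A)\<close> on an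
  open set.\<close>

lemma schur_chart:
  assumes S: "rigid_class S" "A \<in> S"
  defines "\<phi> \<equiv> \<lambda>T. T - correction T"
  shows "cinfinity_diffeo chart_domain (\<phi> ` chart_domain) \<phi>"
    and "openin (top_of_set (tangent_ops A)) (\<phi> ` (S \<inter> chart_domain))"
proof -
  define \<psi> where "\<psi> T = T + correction T" for T
  have dom: "\<phi> T \<in> chart_domain" "\<psi> T \<in> chart_domain" if "T \<in> chart_domain" for T
    using that correction_invariant[of T] by (simp_all add: chart_domain_def \<phi>_def \<psi>_def)
  have corr: "correction (\<phi> T) = correction T" "correction (\<psi> T) = correction T" for T
    using correction_invariant[of T] by (simp_all add: correction_def \<phi>_def \<psi>_def)
  have inv: "\<psi> (\<phi> T) = T" "\<phi> (\<psi> T) = T" for T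
    using corr[of T] by (simp_all add: \<phi>_def \<psi>_def)
  have onto: "\<phi> ` chart_domain = chart_domain"
    using dom inv by (metis image_eqI image_subsetI subsetI subset_antisym)
  have inj: "inj_on \<phi> chart_domain" by (metis inj_onI inv(1))
  have "cinfinity_on chart_domain \<phi>"
  proof -
    have "cinfinity_on chart_domain (\<lambda>T. T + - correction T)"
      by (intro cinfinity_on_add cinfinity_on_ident cinfinity_on_correction
        cinfinity_on_bounded_linear_image[OF bounded_linear_minus[OF bounded_linear_ident]])
    then show ?thesis by (simp add: \<phi>_def)
  qed
  moreover have "cinfinity_on chart_domain (inv_into chart_domain \<phi>)"
  proof (rule cinfinity_on_cong)
    show "cinfinity_on chart_domain \<psi>" unfolding \<psi>_def
      by (intro cinfinity_on_add cinfinity_on_ident cinfinity_on_correction)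
    show "\<psi> T = inv_into chart_domain \<phi> T" if "T \<in> chart_domain" for T
      using inv_into_f_eq[OF inj dom(2)[OF that] inv(2)] by simp
  qed
  ultimately show "cinfinity_diffeo chart_domain (\<phi> ` chart_domain) \<phi>"
    unfolding cinfinity_diffeo_def onto using open_chart_domain inj onto by (simp add: bij_betw_def)
  have tang: "\<phi> T \<in> tangent_ops A \<longleftrightarrow> T \<in> S" if "T \<in> chart_domain" for T
  proof -
    have "coker_proj o\<^sub>L \<phi> T o\<^sub>L ker_proj = schur T"
      by (rule blinfun_eqI) (simp add: \<phi>_def schur_apply blinfun.bilinear_simps)
    then show ?thesis by (simp add: tangent_ops_eq mem_class_iff_schur[OF S that])
  qed
  have "\<phi> ` (S \<inter> chart_domain) = tangent_ops A \<inter> chart_domain"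
  proof (intro equalityI subsetI)
    fix T assume T: "T \<in> tangent_ops A \<inter> chart_domain"
    then have "T = \<phi> (\<psi> T)" "\<psi> T \<in> S \<inter> chart_domain" using tang[of "\<psi> T"] dom inv by auto
    then show "T \<in> \<phi> ` (S \<inter> chart_domain)" by blast
  qed (use tang dom in auto)
  then show "openin (top_of_set (tangent_ops A)) (\<phi> ` (S \<inter> chart_domain))"
    using open_chart_domain by (simp add: openin_open_Int)
qed

text \<open>Along a curve in the class the block 22 equals the correction, whose derivative at \<open>A\<close> is
  zero.\<close>

lemma tangent_space_subset:
  assumes S: "rigid_class S" "A \<in> S"
  shows "tangent_space S A \<subseteq> tangent_ops A"
proof
  fix D assume "D \<in> tangent_space S A"
  then obtain c \<delta> where D: "D = vector_derivative c (at 0)" and \<delta>: "\<delta> > 0"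
    and C1: "c C1_differentiable_on {-\<delta><..<\<delta>}" and cS: "c ` {-\<delta><..<\<delta>} \<subseteq> S" and c0: "c 0 = A"
    unfolding tangent_space_def by blast
  have c': "(c has_vector_derivative D) (at 0)"
    using C1 \<delta> unfolding C1_differentiable_on_eq D vector_derivative_works[symmetric] by simp
  let ?p = "\<lambda>T. coker_proj o\<^sub>L T o\<^sub>L ker_proj"
  have bl: "bounded_linear ?p" by (intro bounded_linear_intros)
  have 1: "((\<lambda>t. ?p (c t)) has_vector_derivative ?p D) (at 0)"
    by (rule bounded_linear.has_vector_derivative[OF bl c'])
  have "(correction has_derivative (\<lambda>h. 0)) (at (c 0))" unfolding c0 by (rule correction_has_derivative)
  then have 2: "((\<lambda>t. correction (c t)) has_derivative (\<lambda>t. 0)) (at 0)"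
    using has_derivative_compose[OF c'[unfolded has_vector_derivative_def]] by blast
  have "isCont c 0" using c' by (rule has_vector_derivative_continuous)
  then have "\<forall>\<^sub>F t in at 0. c t \<in> chart_domain"
    unfolding isCont_def c0 using topological_tendstoD open_chart_domain centre_in_chart_domain by blast
  moreover have "\<forall>\<^sub>F t in at 0. t \<in> {-\<delta><..<\<delta>}"
    using \<delta> by (intro eventually_at_in_open') auto
  ultimately have ev: "\<forall>\<^sub>F t in at 0. correction (c t) = ?p (c t)"
  proof eventually_elim
    case (elim t)
    then have "schur (c t) = 0" using mem_class_iff_schur[OF S, of "c t"] cS by blast
    then show ?case by (simp add: schur_def)
  qed
  have "schur A = 0" using mem_class_iff_schur[OF S centre_in_chart_domain] S(2) by blast
  then have "correction (c 0) = ?p (c 0)" by (simp add: schur_def c0)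
  then have "((\<lambda>t. ?p (c t)) has_derivative (\<lambda>t. 0)) (at 0)"
    by (intro has_derivative_transform_eventually[OF 2 ev]) auto
  then have "((\<lambda>t. ?p (c t)) has_vector_derivative 0) (at 0)" by (simp add: has_vector_derivative_def)
  with 1 have "?p D = 0" by (rule vector_derivative_unique_at)
  then show "D \<in> tangent_ops A" by (simp add: tangent_ops_eq)
qed

text \<open>An operator with vanishing block 22 is \<open>X A + A Y\<close> with \<open>X = T B\<close> and \<open>Y = B T (I - BA)\<close>, hence
  the velocity of \<open>(I + t X) A (I + t Y)\<close>, an equivalence of \<open>A\<close> for small \<open>t\<close>.\<close>

lemma tangent_ops_subset:
  assumes S: "rigid_class S" "A \<in> S"
  shows "tangent_ops A \<subseteq> tangent_space S A"
proof
  fix T assume "T \<in> tangent_ops A"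
  then have T: "coker_proj o\<^sub>L T o\<^sub>L ker_proj = 0" by (simp add: tangent_ops_eq)
  define X where "X = T o\<^sub>L B"
  define Y where "Y = B o\<^sub>L T o\<^sub>L ker_proj"
  define c where "c t = (id_blinfun + t *\<^sub>R X) o\<^sub>L A o\<^sub>L (id_blinfun + t *\<^sub>R Y)" for t :: real
  have c_eq: "c t = A + t *\<^sub>R T + t\<^sup>2 *\<^sub>R (X o\<^sub>L A o\<^sub>L Y)" for t
  proof (rule blinfun_eqI)
    fix x
    have "coker_proj (T (ker_proj x)) = 0" using arg_cong[OF T, of "\<lambda>f. blinfun_apply f x"] by simp
    then have "T x = T (B (A x)) + A (B (T (ker_proj x)))"
      by (simp add: coker_proj_apply ker_proj_apply blinfun.diff_right algebra_simps)
    then show "c t x = (A + t *\<^sub>R T + t\<^sup>2 *\<^sub>R (X o\<^sub>L A o\<^sub>L Y)) x"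
      by (simp add: c_def X_def Y_def blinfun.bilinear_simps algebra_simps power2_eq_square)
  qed
  \<comment> \<open>Small enough for the Neumann inverses of both factors.\<close>
  define \<delta> where "\<delta> = 1 / (2 * (norm X + norm Y + 1))"
  have \<delta>: "\<delta> > 0" by (simp add: \<delta>_def add_nonneg_pos)
  have inv: "id_blinfun + t *\<^sub>R Z \<in> invertibles"
    if "t \<in> {-\<delta><..<\<delta>}" "norm Z \<le> norm X + norm Y + 1" for t and Z :: "'x::banach \<Rightarrow>\<^sub>L 'x"
  proof -
    have "norm (t *\<^sub>R Z) \<le> \<delta> * (norm X + norm Y + 1)"
      unfolding norm_scaleR using that \<delta> by (intro mult_mono) auto
    also have "\<dots> = 1/2" by (simp add: \<delta>_def field_simps add_nonneg_eq_0_iff)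
    finally obtain s where "is_inverse (id_blinfun + t *\<^sub>R Z) s" by (rule neumann_inverse)
    then show ?thesis by (auto simp: invertibles_def)
  qed
  have "c t \<in> S" if "t \<in> {-\<delta><..<\<delta>}" for t
  proof -
    have "id_blinfun + t *\<^sub>R X \<in> invertibles" "id_blinfun + t *\<^sub>R Y \<in> invertibles"
      using that by (auto intro!: inv)
    then show ?thesis unfolding c_def by (rule rigid_class_equivalence[OF S])
  qed
  moreover have der: "(c has_vector_derivative (T + (2 * t) *\<^sub>R (X o\<^sub>L A o\<^sub>L Y))) (at t)" for t
    unfolding c_eq by (auto intro!: derivative_eq_intros)
  have "c C1_differentiable_on {-\<delta><..<\<delta>}"
    unfolding C1_differentiable_on_def using der
    by (intro exI[of _ "\<lambda>t. T + (2 * t) *\<^sub>R (X o\<^sub>L A o\<^sub>L Y)"]) (auto intro!: continuous_intros)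
  moreover have "vector_derivative c (at 0) = T" using vector_derivative_at[OF der[of 0]] by simp
  moreover have "c 0 = A" by (simp add: c_eq)
  ultimately show "T \<in> tangent_space S A" unfolding tangent_space_def using \<delta> by blast
qed

end

theorem theorem4p2:
  fixes S :: "('e::banach \<Rightarrow>\<^sub>L 'f::banach) set"
  assumes "(\<exists>k\<ge>1. S = rank_class k) \<or>
           (\<exists>m n :: nat. S = Phi_class (enat m) (enat n)) \<or>
           (\<exists>m :: nat. S = Phi_class (enat m) \<infinity>) \<or>
           (\<exists>n :: nat. S = Phi_class \<infinity> (enat n))"
  shows "smooth_submanifold S \<and> (\<forall>Z\<in>S. tangent_space S Z = tangent_ops Z)"
proof -
  have rigid: "rigid_class S" using assms by (auto intro: rigid_class_rank rigid_class_Phi)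
  have gen: "\<exists>B. generalized_inverse Z B" if "Z \<in> S" for Z
  proof -
    have "Z \<in> double_split" using rigid_class_double_split[OF rigid] that by blast
    then show ?thesis
      by (rule double_split_generalized_inverse) (rule exI, rule generalized_inverse.intro)
  qed
  have "smooth_submanifold S"
    unfolding smooth_submanifold_def
  proof
    fix Z assume Z: "Z \<in> S"
    then obtain B where "generalized_inverse Z B" using gen by blast
    then interpret generalized_inverse Z B .
    show "\<exists>E\<^sub>0 U (\<phi> :: ('e \<Rightarrow>\<^sub>L 'f) \<Rightarrow> 'e \<Rightarrow>\<^sub>L 'f). closed E\<^sub>0 \<and> (\<exists>C. closed C \<and> complementary E\<^sub>0 C) \<and>
        Z \<in> U \<and> cinfinity_diffeo U (\<phi> ` U) \<phi> \<and> openin (top_of_set E\<^sub>0) (\<phi> ` (S \<inter> U))"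
      using tangent_ops_complemented centre_in_chart_domain schur_chart[OF rigid Z] by blast
  qed
  moreover have "tangent_space S Z = tangent_ops Z" if Z: "Z \<in> S" for Z
  proof -
    obtain B where "generalized_inverse Z B" using gen Z by blast
    then interpret generalized_inverse Z B .
    show ?thesis using tangent_space_subset[OF rigid Z] tangent_ops_subset[OF rigid Z] by (rule antisym)
  qed
  ultimately show ?thesis by blast
qed

end
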